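(* Assume $\{F_j\}_{j\in\mathbb Z_+}$ is i.i.d. under $\mathbb P$ and satisfies $$\mathbf E|X(z)|<\infty,\qquad \int_0^\infty\bigl\{1-\mathbb E(F_0(x))\bigr\}^{1/2}dx<\infty,\qquad\int_0^\infty\operatorname*{ess\,sup}_{\mathbb P}(1-F_0(x))\,dx<\infty .$$ Assume there exist constants $t_0>0$ and $K_0<\infty$ such that $$\operatorname*{ess\,sup}_{\mathbb P}\,E^{F}e^{t_0|X-\mu(F)|}<K_0 .$$ Let $\mu^*=\operatorname{ess\,sup}_{\mathbb P}\mu(F)$. Then, as $\alpha\searrow0$, $$\Psi(1,\alpha)=\mu^*+O\Bigl(\sqrt{\alpha\log\tfrac1\alpha}\Bigr).$$
   Context: $\mathbb P$ is a probability measure on sequences $(F_j)_{j\in\mathbb Z_+}$ of Borel probability distributions on $\mathbb R$ (the environment), with expectation $\mathbb E$; $F_j(\cdot)$ also denotes the distribution function. Given $(F_j)$, the weights $\{X(i,j):(i,j)\in\mathbb Z_+^2\}$ are independent with $X(i,j)\sim F_j$; $\mathbf E$ is expectation over environment and weights. $T(k,\ell)$ is the maximum of $\sum_{z\in\pi}X(z)$ over all nearest-neighbor lattice paths $\pi$ from $(0,0)$ to $(k,\ell)$ with steps $(1,0)$ or $(0,1)$, the endpoint $(k,\ell)$ excluded. $\Psi(x,y)=\lim_{n\to\infty}\frac1nT(\lfloor nx\rfloor,\lfloor ny\rfloor)$, $(x,y)\in(0,\infty)^2$, is the deterministic limit, almost sure and in $L^1$. For a distribution $F$, $\mu(F)$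 is its mean and $E^F$ denotes expectation when $X\sim F$; in the essential suprema $F$ stands for the random distribution $F_0$ under $\mathbb P$. $\operatorname{ess\,sup}_{\mathbb P}f=\inf\{s\in\mathbb R:\mathbb P(f>s)=0\}$. *)

theory Defs
  imports "HOL-Probability.Probability" "HOL-Library.Landau_Symbols"
begin

text \<open>
  The environment \<open>F\<close> and the weights \<open>X\<close> live on one probability space \<open>M\<close>, so that the law of \<open>F\<close>
  under \<open>M\<close> is the environment measure and expectation under \<open>M\<close> is expectation over environment
  and weights jointly.  The index of \<open>F\<close> is the second coordinate of the lattice point.
  Assumption \<open>quenched_law\<close> says that, conditionally on the sigma-algebra generated by the
  environment, the weights are independent and \<open>X (i, j)\<close> has law \<open>F j\<close>; for each family of
  Borel sets it is the defining equation of that conditional probability.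
\<close>

locale random_environment = prob_space M
  for M :: "'a measure"
    and F :: "nat \<Rightarrow> 'a \<Rightarrow> real measure"
    and X :: "nat \<times> nat \<Rightarrow> 'a \<Rightarrow> real" +
  assumes env_measurable: "\<And>j. F j \<in> M \<rightarrow>\<^sub>M prob_algebra borel"
    and weight_measurable: "\<And>z. X z \<in> borel_measurable M"
    and quenched_law:
      "\<And>I A E. finite I \<Longrightarrow> (\<And>z. z \<in> I \<Longrightarrow> A z \<in> sets borel) \<Longrightarrow>
         E \<in> sets (PiM UNIV (\<lambda>_::nat. prob_algebra (borel :: real measure))) \<Longrightarrow>
         prob {\<omega> \<in> space M. (\<lambda>j. F j \<omega>) \<in> E \<and> (\<forall>z\<in>I. X z \<omega> \<in> A z)} =
         expectation (\<lambda>\<omega>. indicator E (\<lambda>j. F j \<omega>) * (\<Prod>z\<in>I. measure (F (snd z) \<omega>) (A z)))"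

definition iid_environment :: "'a measure \<Rightarrow> (nat \<Rightarrow> 'a \<Rightarrow> real measure) \<Rightarrow> bool" where
  "iid_environment M F \<longleftrightarrow>
     prob_space.indep_vars M (\<lambda>_. prob_algebra borel) F UNIV \<and>
     (\<forall>j. distr M (prob_algebra borel) (F j) = distr M (prob_algebra borel) (F 0))"

definition dist_mean :: "real measure \<Rightarrow> real" where
  "dist_mean G = (\<integral>x. x \<partial>G)"

definition lattice_paths :: "nat \<Rightarrow> nat \<Rightarrow> (nat \<times> nat) list set" where
  "lattice_paths k l = {p. p \<noteq> [] \<and> hd p = (0, 0) \<and> last p = (k, l) \<and>
     successively (\<lambda>u v. v = (Suc (fst u), snd u) \<or> v = (fst u, Suc (snd u))) p}"

text \<open>The final point \<open>(k, l)\<close> of the path is excluded by \<open>butlast\<close>.\<close>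

definition last_passage :: "(nat \<times> nat \<Rightarrow> real) \<Rightarrow> nat \<Rightarrow> nat \<Rightarrow> real" where
  "last_passage w k l = Max ((\<lambda>p. \<Sum>z\<leftarrow>butlast p. w z) ` lattice_paths k l)"

definition scaled_passage :: "(nat \<times> nat \<Rightarrow> 'a \<Rightarrow> real) \<Rightarrow> real \<Rightarrow> real \<Rightarrow> nat \<Rightarrow> 'a \<Rightarrow> real" where
  "scaled_passage X x y n \<omega> =
     last_passage (\<lambda>z. X z \<omega>) (nat \<lfloor>real n * x\<rfloor>) (nat \<lfloor>real n * y\<rfloor>) / real n"

text \<open>
  \<open>Psi\<close> is the deterministic limit, almost surely and in \<open>L\<^sup>1\<close>, in every direction of the open
  quadrant.  Its values outside the open quadrant are irrelevant.
\<close>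

definition limit_shape ::
  "'a measure \<Rightarrow> (nat \<times> nat \<Rightarrow> 'a \<Rightarrow> real) \<Rightarrow> (real \<Rightarrow> real \<Rightarrow> real) \<Rightarrow> bool" where
  "limit_shape M X Psi \<longleftrightarrow>
     (\<forall>x>0. \<forall>y>0.
        (AE \<omega> in M. (\<lambda>n. scaled_passage X x y n \<omega>) \<longlonglongrightarrow> Psi x y) \<and>
        (\<lambda>n. \<integral>\<^sup>+\<omega>. ennreal \<bar>scaled_passage X x y n \<omega> - Psi x y\<bar> \<partial>M) \<longlonglongrightarrow> 0)"

lemma lattice_paths_bound:
  assumes "successively (\<lambda>u v. v = (Suc (fst u), snd u) \<or> v = (fst u, Suc (snd u))) p"
    and "p \<noteq> []"
  shows "set p \<subseteq> {..fst (last p)} \<times> {..snd (last p)} \<and>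
    length p + fst (hd p) + snd (hd p) = Suc (fst (last p) + snd (last p))"
  using assms
proof (induction p)
  case (Cons u p)
  show ?case
  proof (cases p)
    case Nil
    then show ?thesis by (cases u) simp
  next
    case (Cons v q)
    then have step: "v = (Suc (fst u), snd u) \<or> v = (fst u, Suc (snd u))"
      and IH: "set p \<subseteq> {..fst (last p)} \<times> {..snd (last p)}"
        "length p + fst v + snd v = Suc (fst (last p) + snd (last p))"
      using Cons.IH Cons.prems by auto
    have "v \<in> {..fst (last p)} \<times> {..snd (last p)}"
      using IH(1) Cons by auto
    with step have "u \<in> {..fst (last p)} \<times> {..snd (last p)}"
      by (cases u) auto
    then show ?thesis using IH step Cons by auto
  qed
qed simp

lemma finite_lattice_paths: "finite (lattice_paths k l)"
proof (rule finite_subset)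
  show "lattice_paths k l \<subseteq> {p. set p \<subseteq> {..k} \<times> {..l} \<and> length p \<le> Suc (k + l)}"
    using lattice_paths_bound by (fastforce simp: lattice_paths_def)
qed (rule finite_lists_length_le, simp)

lemma lattice_paths_nonempty: "lattice_paths k l \<noteq> {}"
proof -
  have snoc: "successively P (p @ [v])" if "successively P p" "p \<noteq> []" "P (last p) v"
    for P and p :: "(nat \<times> nat) list" and v
    using that by (simp add: successively_append_iff)
  have "\<exists>p. p \<in> lattice_paths k 0"
  proof (induction k)
    case 0
    show ?case by (rule exI[of _ "[(0, 0)]"]) (simp add: lattice_paths_def)
  next
    case (Suc k)
    then obtain p where "p \<in> lattice_paths k 0" ..
    then have "p @ [(Suc k, 0)] \<in> lattice_paths (Suc k) 0"
      by (auto simp: lattice_paths_def intro!: snoc)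
    then show ?case ..
  qed
  then have "\<exists>p. p \<in> lattice_paths k l"
  proof (induction l)
    case (Suc l)
    then obtain p where "p \<in> lattice_paths k l" by auto
    then have "p @ [(k, Suc l)] \<in> lattice_paths k (Suc l)"
      by (auto simp: lattice_paths_def intro!: snoc)
    then show ?case ..
  qed
  then show ?thesis by auto
qed

text \<open>
  The library sets \<open>esssup\<close> to \<open>top\<close> for non-measurable functions; the following facts show that
  this convention never applies to the essential suprema of interest.
\<close>

context random_environment
begin

lemma env_measurable_subprob [measurable]: "F j \<in> M \<rightarrow>\<^sub>M subprob_algebra borel"
  using env_measurable by (rule measurable_prob_algebraD)

lemma cdf_env_measurable: "(\<lambda>\<omega>. cdf (F j \<omega>) x) \<in> borel_measurable M"
  unfolding cdf_def by measurable

lemma dist_mean_env_measurable: "(\<lambda>\<omega>. dist_mean (F j \<omega>)) \<in> borel_measurable M"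
  unfolding dist_mean_def by measurable

lemma exp_moment_env_measurable:
  "(\<lambda>\<omega>. \<integral>\<^sup>+x. ennreal (exp (t * \<bar>x - dist_mean (F j \<omega>)\<bar>)) \<partial>F j \<omega>) \<in> borel_measurable M"
proof (rule nn_integral_measurable_subprob_algebra2[where N = borel])
  have [measurable]: "(\<lambda>\<omega>. dist_mean (F j \<omega>)) \<in> borel_measurable M"
    by (rule dist_mean_env_measurable)
  show "(\<lambda>(\<omega>, x). ennreal (exp (t * \<bar>x - dist_mean (F j \<omega>)\<bar>))) \<in> borel_measurable (M \<Otimes>\<^sub>M borel)"
    by measurable
qed measurable

end

end

theory Submission
  imports Defs "HOL-Real_Asymp.Real_Asymp"
begin

text \<open>
  Lower bound: the limit is deterministic, so it may be computed on the event \<open>B\<close> that the mean of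
  row 0 is at least \<open>s\<close>, as soon as \<open>B\<close> has positive probability.  The path that follows row 0 and
  then goes straight up collects at least \<open>s n\<close> on row 0 in conditional mean.  The other rows are
  independent of \<open>B\<close>, so the column costs at most \<open>\<alpha> n \<^bold>E\<bar>X\<bar>\<close> whatever the probability of \<open>B\<close>, and \<open>s\<close> can
  tend to \<open>\<mu>\<^sup>*\<close>.  The same inequality shows that \<open>\<mu>\<^sup>*\<close> is finite.

  Upper bound: for weights centred by their row means, the conditional exponential moment at \<open>\<theta>\<close> is at most
  \<open>exp (c \<theta>\<^sup>2)\<close> per site.  There are at most \<open>(1 - \<alpha>) powr - k * \<alpha> powr - l\<close> paths to \<open>(k, l)\<close>, so summing
  exponential moments over all paths bounds the mean excess of \<open>T\<close> over \<open>(k + l) \<mu>\<^sup>*\<close> by a multiple of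
  \<open>n (\<alpha> ln (1 / \<alpha>) / \<theta> + \<theta>)\<close>, and \<open>\<theta> = sqrt (\<alpha> ln (1 / \<alpha>))\<close> balances the two terms.
\<close>

section \<open>Conditioning on the environment\<close>

text \<open>Linearity and monotone limits carry the identity from indicators to all nonnegative
  \<open>f\<close>. The weights \<open>\<Phi>\<close> and \<open>\<Psi>\<close> may differ so that
  factors already treated can be carried along: evaluated at the random variables on the left,
  averaged over their kernels on the right.\<close>

lemma nn_integral_kernel_eqI:
  fixes M :: "'a measure" and \<Phi> \<Psi> :: "'a \<Rightarrow> ennreal"
  assumes [measurable]: "\<Phi> \<in> borel_measurable M" "\<Psi> \<in> borel_measurable M"
    "Y \<in> M \<rightarrow>\<^sub>M N" "G \<in> M \<rightarrow>\<^sub>M subprob_algebra N"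
    and eq: "\<And>A. A \<in> sets N \<Longrightarrow>
      (\<integral>\<^sup>+\<omega>. \<Phi> \<omega> * indicator A (Y \<omega>) \<partial>M) = (\<integral>\<^sup>+\<omega>. \<Psi> \<omega> * emeasure (G \<omega>) A \<partial>M)"
    and f: "f \<in> borel_measurable N"
  shows "(\<integral>\<^sup>+\<omega>. \<Phi> \<omega> * f (Y \<omega>) \<partial>M) = (\<integral>\<^sup>+\<omega>. \<Psi> \<omega> * (\<integral>\<^sup>+x. f x \<partial>G \<omega>) \<partial>M)"
  using f
proof (induction rule: borel_measurable_induct)
  have [measurable_cong]: "\<And>\<omega>. \<omega> \<in> space M \<Longrightarrow> sets (G \<omega>) = sets N"
    using assms(4) by (rule sets_kernel)
  {
    case (cong f g)
    have "(\<integral>\<^sup>+\<omega>. \<Phi> \<omega> * g (Y \<omega>) \<partial>M) = (\<integral>\<^sup>+\<omega>. \<Phi> \<omega> * f (Y \<omega>) \<partial>M)"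
      by (intro nn_integral_cong) (simp add: cong(3) measurable_space[OF assms(3)])
    moreover have "(\<integral>\<^sup>+\<omega>. \<Psi> \<omega> * (\<integral>\<^sup>+x. g x \<partial>G \<omega>) \<partial>M) = (\<integral>\<^sup>+\<omega>. \<Psi> \<omega> * (\<integral>\<^sup>+x. f x \<partial>G \<omega>) \<partial>M)"
      using cong(3) sets_eq_imp_space_eq[OF sets_kernel[OF assms(4)]]
      by (intro nn_integral_cong arg_cong2[where f = "(*)"]) auto
    ultimately show ?case using cong by simp
  next
    case (set A)
    have "(\<integral>\<^sup>+\<omega>. \<Psi> \<omega> * (\<integral>\<^sup>+x. indicator A x \<partial>G \<omega>) \<partial>M) = (\<integral>\<^sup>+\<omega>. \<Psi> \<omega> * emeasure (G \<omega>) A \<partial>M)"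
      using set sets_kernel[OF assms(4)] by (intro nn_integral_cong) simp
    with eq[OF set] show ?case by simp
  next
    case (mult u c)
    note [measurable] = mult(2)
    have "(\<integral>\<^sup>+\<omega>. \<Phi> \<omega> * (c * u (Y \<omega>)) \<partial>M) = c * (\<integral>\<^sup>+\<omega>. \<Phi> \<omega> * u (Y \<omega>) \<partial>M)"
      by (subst nn_integral_cmult[symmetric]) (auto simp: mult_ac)
    moreover have "(\<integral>\<^sup>+\<omega>. \<Psi> \<omega> * (\<integral>\<^sup>+x. c * u x \<partial>G \<omega>) \<partial>M)
        = (\<integral>\<^sup>+\<omega>. c * (\<Psi> \<omega> * (\<integral>\<^sup>+x. u x \<partial>G \<omega>)) \<partial>M)"
      by (intro nn_integral_cong, subst nn_integral_cmult) (auto simp: mult_ac)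
    moreover have "\<dots> = c * (\<integral>\<^sup>+\<omega>. \<Psi> \<omega> * (\<integral>\<^sup>+x. u x \<partial>G \<omega>) \<partial>M)"
      using nn_integral_measurable_subprob_algebra2[where N = N and L = G and f = "\<lambda>_. u" and M = M]
      by (intro nn_integral_cmult) simp
    ultimately show ?case using mult by simp
  next
    case (add u v)
    note [measurable] = add(1,3)
    have K: "(\<lambda>\<omega>. \<integral>\<^sup>+x. w x \<partial>G \<omega>) \<in> borel_measurable M" if [measurable]: "w \<in> borel_measurable N" for w :: "_ \<Rightarrow> ennreal"
      by (rule nn_integral_measurable_subprob_algebra2[where N = N]) measurable
    note [measurable] = K[OF add(1)] K[OF add(3)]
    have "(\<integral>\<^sup>+\<omega>. \<Phi> \<omega> * (v (Y \<omega>) + u (Y \<omega>)) \<partial>M) = (\<integral>\<^sup>+\<omega>. \<Phi> \<omega> * v (Y \<omega>) \<partial>M) + (\<integral>\<^sup>+\<omega>. \<Phi> \<omega> * u (Y \<omega>) \<partial>M)"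
      by (subst nn_integral_add[symmetric]) (auto simp: distrib_left)
    moreover have "(\<integral>\<^sup>+\<omega>. \<Psi> \<omega> * (\<integral>\<^sup>+x. v x + u x \<partial>G \<omega>) \<partial>M)
        = (\<integral>\<^sup>+\<omega>. \<Psi> \<omega> * (\<integral>\<^sup>+x. v x \<partial>G \<omega>) + \<Psi> \<omega> * (\<integral>\<^sup>+x. u x \<partial>G \<omega>) \<partial>M)"
      by (intro nn_integral_cong, subst nn_integral_add) (auto simp: distrib_left)
    moreover have "\<dots> = (\<integral>\<^sup>+\<omega>. \<Psi> \<omega> * (\<integral>\<^sup>+x. v x \<partial>G \<omega>) \<partial>M) + (\<integral>\<^sup>+\<omega>. \<Psi> \<omega> * (\<integral>\<^sup>+x. u x \<partial>G \<omega>) \<partial>M)"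
      by (rule nn_integral_add) auto
    ultimately show ?case using add by simp
  next
    case (seq U)
    note [measurable] = seq(1)
    have K: "(\<lambda>\<omega>. \<integral>\<^sup>+x. U i x \<partial>G \<omega>) \<in> borel_measurable M" for i
      by (rule nn_integral_measurable_subprob_algebra2[where N = N]) measurable
    note [measurable] = K
    have mono: "U i x \<le> U (Suc i) x" for i x
      using seq(3) by (auto simp: incseq_Suc_iff le_fun_def)
    \<comment> \<open>Monotone convergence is used three times: under \<open>M\<close> on either
      side of the induction hypothesis, and under each \<open>G \<omega>\<close>.\<close>
    have "(\<integral>\<^sup>+\<omega>. \<Phi> \<omega> * (SUP i. U i) (Y \<omega>) \<partial>M) = (\<integral>\<^sup>+\<omega>. (SUP i. \<Phi> \<omega> * U i (Y \<omega>)) \<partial>M)"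
      by (simp add: SUP_mult_left_ennreal image_comp)
    also have "\<dots> = (SUP i. \<integral>\<^sup>+\<omega>. \<Phi> \<omega> * U i (Y \<omega>) \<partial>M)"
      by (rule nn_integral_monotone_convergence_SUP)
         (auto simp: incseq_Suc_iff le_fun_def intro!: mult_left_mono mono)
    also have "\<dots> = (SUP i. \<integral>\<^sup>+\<omega>. \<Psi> \<omega> * (\<integral>\<^sup>+x. U i x \<partial>G \<omega>) \<partial>M)"
      using seq by simp
    also have "\<dots> = (\<integral>\<^sup>+\<omega>. (SUP i. \<Psi> \<omega> * (\<integral>\<^sup>+x. U i x \<partial>G \<omega>)) \<partial>M)"
      by (rule nn_integral_monotone_convergence_SUP[symmetric])
         (auto simp: incseq_Suc_iff le_fun_def intro!: mult_left_mono mono nn_integral_mono)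
    also have "\<dots> = (\<integral>\<^sup>+\<omega>. \<Psi> \<omega> * (\<integral>\<^sup>+x. (SUP i. U i) x \<partial>G \<omega>) \<partial>M)"
    proof (rule nn_integral_cong)
      fix \<omega> assume "\<omega> \<in> space M"
      have [measurable]: "U i \<in> borel_measurable (G \<omega>)" for i
        using seq(1) measurable_cong_sets[OF sets_kernel[OF assms(4) \<open>\<omega> \<in> space M\<close>] refl] by blast
      have "(\<integral>\<^sup>+x. (SUP i. U i x) \<partial>G \<omega>) = (SUP i. \<integral>\<^sup>+x. U i x \<partial>G \<omega>)"
        by (rule nn_integral_monotone_convergence_SUP)
           (auto simp: incseq_Suc_iff le_fun_def intro!: mono)
      then show "(SUP i. \<Psi> \<omega> * (\<integral>\<^sup>+x. U i x \<partial>G \<omega>)) = \<Psi> \<omega> * (\<integral>\<^sup>+x. (SUP i. U i) x \<partial>G \<omega>)"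
        by (simp add: SUP_mult_left_ennreal image_comp)
    qed
    finally show ?case .
  }
qed

section \<open>Averaging out finitely many weights given the environment\<close>

context random_environment
begin

abbreviation env_space :: "(nat \<Rightarrow> real measure) measure" where
  "env_space \<equiv> PiM UNIV (\<lambda>_::nat. prob_algebra borel)"

abbreviation env :: "'a \<Rightarrow> nat \<Rightarrow> real measure" where
  "env \<omega> \<equiv> \<lambda>j. F j \<omega>"

lemma env_sequence_measurable: "env \<in> M \<rightarrow>\<^sub>M env_space"
  by (rule measurable_PiM_single') (auto simp: env_measurable measurable_space[OF env_measurable] PiE_iff)

lemma env_kernel_measurable:
  assumes "f \<in> borel_measurable borel"
  shows "(\<lambda>\<omega>. \<integral>\<^sup>+x. f x \<partial>F j \<omega>) \<in> borel_measurable M"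
proof (rule nn_integral_measurable_subprob_algebra2[where N = borel])
  note [measurable] = assms
  show "(\<lambda>(\<omega>, x). f x) \<in> borel_measurable (M \<Otimes>\<^sub>M borel)" by measurable
qed (rule env_measurable_subprob)

lemma env_prob_space:
  assumes "\<omega> \<in> space M"
  shows "prob_space (F j \<omega>)" "sets (F j \<omega>) = sets borel"
  using measurable_space[OF env_measurable assms] by (auto simp: space_prob_algebra)

lemma env_borel_measurable:
  assumes "\<omega> \<in> space M" and "f \<in> borel_measurable borel"
  shows "f \<in> borel_measurable (F j \<omega>)"
  using assms(2) measurable_cong_sets[OF env_prob_space(2)[OF assms(1), of j] refl] by blast

text \<open>This is \<open>quenched_law\<close> rewritten with nonnegative integrals, so that
  indicators can later be replaced by unbounded functions without integrability conditions. The
  Bochner integral in \<open>quenched_law\<close> is a genuine one because its integrand lies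
  between 0 and 1.\<close>

lemma nn_integral_quenched_indicator:
  assumes "finite I" and "E \<in> sets env_space"
    and "\<And>z. z \<in> I \<Longrightarrow> A z \<in> sets borel"
  shows "(\<integral>\<^sup>+\<omega>. indicator E (env \<omega>) * (\<Prod>z\<in>I. indicator (A z) (X z \<omega>)) \<partial>M) =
    (\<integral>\<^sup>+\<omega>. indicator E (env \<omega>) * (\<Prod>z\<in>I. emeasure (F (snd z) \<omega>) (A z)) \<partial>M)"
proof -
  note [measurable] = env_sequence_measurable weight_measurable assms
  let ?B = "{\<omega> \<in> space M. env \<omega> \<in> E \<and> (\<forall>z\<in>I. X z \<omega> \<in> A z)}"
  have B: "?B \<in> sets M"
    using assms(1) by measurable
  have "(\<Prod>z\<in>I. indicator (A z) (X z \<omega>)) = (indicator {w. \<forall>z\<in>I. X z w \<in> A z} \<omega> :: ennreal)" for \<omega>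
    using assms(1) by (induction I rule: finite_induct) (auto simp: indicator_def)
  then have "(\<integral>\<^sup>+\<omega>. indicator E (env \<omega>) * (\<Prod>z\<in>I. indicator (A z) (X z \<omega>)) \<partial>M)
      = (\<integral>\<^sup>+\<omega>. indicator ?B \<omega> \<partial>M)"
    by (intro nn_integral_cong) (auto simp: indicator_def)
  also have "\<dots> = emeasure M ?B" using B by simp
  also have "\<dots> = ennreal (prob ?B)" by (simp add: emeasure_eq_measure)
  also have "\<dots> = ennreal (\<integral>\<omega>. indicator E (env \<omega>) * (\<Prod>z\<in>I. measure (F (snd z) \<omega>) (A z)) \<partial>M)"
    using quenched_law[OF assms(1,3,2)] by simp
  also have "\<dots> = (\<integral>\<^sup>+\<omega>. ennreal (indicator E (env \<omega>) * (\<Prod>z\<in>I. measure (F (snd z) \<omega>) (A z))) \<partial>M)"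
  proof (rule nn_integral_eq_integral[symmetric])
    show "integrable M (\<lambda>\<omega>. indicator E (env \<omega>) * (\<Prod>z\<in>I. measure (F (snd z) \<omega>) (A z)))"
    proof (rule integrable_const_bound[of _ 1])
      show "AE \<omega> in M. norm (indicator E (env \<omega>) * (\<Prod>z\<in>I. measure (F (snd z) \<omega>) (A z)) :: real) \<le> 1"
      proof (rule AE_I2)
        fix \<omega> assume "\<omega> \<in> space M"
        then have "(\<Prod>z\<in>I. measure (F (snd z) \<omega>) (A z)) \<le> 1"
          by (intro prod_le_1) (auto intro: prob_space.prob_le_1 env_prob_space)
        then show "norm (indicator E (env \<omega>) * (\<Prod>z\<in>I. measure (F (snd z) \<omega>) (A z)) :: real) \<le> 1"
          by (auto simp: indicator_def prod_nonneg)
      qed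
      show "(\<lambda>\<omega>. indicator E (env \<omega>) * (\<Prod>z\<in>I. measure (F (snd z) \<omega>) (A z)) :: real) \<in> borel_measurable M"
        by (intro borel_measurable_times borel_measurable_prod borel_measurable_indicator')
          (use measurable_compose[OF env_measurable_subprob measurable_measure_subprob_algebra] assms in \<open>measurable\<close>)
    qed
  qed (auto intro!: prod_nonneg AE_I2 mult_nonneg_nonneg)
  also have "\<dots> = (\<integral>\<^sup>+\<omega>. indicator E (env \<omega>) * (\<Prod>z\<in>I. emeasure (F (snd z) \<omega>) (A z)) \<partial>M)"
  proof (rule nn_integral_cong)
    fix \<omega> assume "\<omega> \<in> space M"
    then have "emeasure (F j \<omega>) B = ennreal (measure (F j \<omega>) B)" for j B
      using finite_measure.emeasure_eq_measure[OF prob_space.finite_measure[OF env_prob_space(1)]] by blast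
    then show "ennreal (indicator E (env \<omega>) * (\<Prod>z\<in>I. measure (F (snd z) \<omega>) (A z)))
        = indicator E (env \<omega>) * (\<Prod>z\<in>I. emeasure (F (snd z) \<omega>) (A z))"
      by (simp add: ennreal_mult prod_nonneg prod_ennreal ennreal_indicator)
  qed
  finally show ?thesis .
qed

text \<open>The set \<open>J\<close> collects the sites whose factor is arbitrary; at the other
  sites of \<open>I\<close> it is still an indicator. The induction releases one site at a time,
  starting from the case of indicators only.\<close>

lemma nn_integral_quenched_prod_aux:
  assumes "finite J" "finite I" "J \<subseteq> I" and E: "E \<in> sets env_space"
    and "\<And>z. z \<in> I \<Longrightarrow> g z \<in> borel_measurable borel"
    and "\<And>z. z \<in> I - J \<Longrightarrow> \<exists>A\<in>sets borel. g z = indicator A"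
  shows "(\<integral>\<^sup>+\<omega>. indicator E (env \<omega>) * (\<Prod>z\<in>I. g z (X z \<omega>)) \<partial>M) =
    (\<integral>\<^sup>+\<omega>. indicator E (env \<omega>) * (\<Prod>z\<in>I. \<integral>\<^sup>+x. g z x \<partial>F (snd z) \<omega>) \<partial>M)"
  using assms(1,3,5,6)
proof (induction J arbitrary: g rule: finite_induct)
  case empty
  then obtain A where A: "\<And>z. z \<in> I \<Longrightarrow> A z \<in> sets borel" "\<And>z. z \<in> I \<Longrightarrow> g z = indicator (A z)"
    by (metis Diff_empty)
  have "(\<integral>\<^sup>+\<omega>. indicator E (env \<omega>) * (\<Prod>z\<in>I. \<integral>\<^sup>+x. g z x \<partial>F (snd z) \<omega>) \<partial>M)
      = (\<integral>\<^sup>+\<omega>. indicator E (env \<omega>) * (\<Prod>z\<in>I. emeasure (F (snd z) \<omega>) (A z)) \<partial>M)"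
    using A env_prob_space by (intro nn_integral_cong arg_cong2[where f = "(*)"] prod.cong) auto
  moreover have "(\<integral>\<^sup>+\<omega>. indicator E (env \<omega>) * (\<Prod>z\<in>I. g z (X z \<omega>)) \<partial>M) =
    (\<integral>\<^sup>+\<omega>. indicator E (env \<omega>) * (\<Prod>z\<in>I. indicator (A z) (X z \<omega>)) \<partial>M)"
    using A by (intro nn_integral_cong arg_cong2[where f = "(*)"] prod.cong) auto
  ultimately show ?case
    using nn_integral_quenched_indicator[of I E A, OF assms(2) E] A by simp
next
  case (insert j J)
  note [measurable] = env_sequence_measurable weight_measurable E
  note g = insert.prems(2)
  have jI: "j \<in> I" using insert by auto
  have split: "(\<Prod>z\<in>I. \<phi> z) = (\<Prod>z\<in>I - {j}. \<phi> z) * \<phi> j" for \<phi> :: "nat \<times> nat \<Rightarrow> ennreal"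
    using jI assms(2) by (subst prod.remove[of I j]) (auto simp: mult.commute)
  let ?\<Phi> = "\<lambda>\<omega>. indicator E (env \<omega>) * (\<Prod>z\<in>I - {j}. g z (X z \<omega>))"
  let ?\<Psi> = "\<lambda>\<omega>. indicator E (env \<omega>) * (\<Prod>z\<in>I - {j}. \<integral>\<^sup>+x. g z x \<partial>F (snd z) \<omega>)"
  have "(\<integral>\<^sup>+\<omega>. ?\<Phi> \<omega> * g j (X j \<omega>) \<partial>M) = (\<integral>\<^sup>+\<omega>. ?\<Psi> \<omega> * (\<integral>\<^sup>+x. g j x \<partial>F (snd j) \<omega>) \<partial>M)"
  proof (rule nn_integral_kernel_eqI[where N = borel])
    show "?\<Phi> \<in> borel_measurable M"
      using measurable_compose[OF weight_measurable g]
      by (auto intro!: borel_measurable_times borel_measurable_prod)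
    show "?\<Psi> \<in> borel_measurable M"
      using env_kernel_measurable[OF g]
      by (auto intro!: borel_measurable_times borel_measurable_prod)
    show "X j \<in> borel_measurable M" "F (snd j) \<in> M \<rightarrow>\<^sub>M subprob_algebra borel"
      "g j \<in> borel_measurable borel"
      using g[OF jI] by measurable
    fix A :: "real set" assume A: "A \<in> sets borel"
    \<comment> \<open>With an indicator put back at site \<open>j\<close>, the induction hypothesis
      applies and supplies exactly the set-wise identity that the kernel lemma asks for.\<close>
    have "(\<integral>\<^sup>+\<omega>. indicator E (env \<omega>) * (\<Prod>z\<in>I. (g(j := indicator A)) z (X z \<omega>)) \<partial>M) =
      (\<integral>\<^sup>+\<omega>. indicator E (env \<omega>) * (\<Prod>z\<in>I. \<integral>\<^sup>+x. (g(j := indicator A)) z x \<partial>F (snd z) \<omega>) \<partial>M)"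
      using insert.prems A by (intro insert.IH) (auto simp: fun_upd_def)
    also have "\<dots> = (\<integral>\<^sup>+\<omega>. ?\<Psi> \<omega> * emeasure (F (snd j) \<omega>) A \<partial>M)"
      using A env_prob_space by (intro nn_integral_cong) (simp add: split mult.assoc)
    finally show "(\<integral>\<^sup>+\<omega>. ?\<Phi> \<omega> * indicator A (X j \<omega>) \<partial>M) = \<dots>"
      by (simp add: split mult.assoc)
  qed
  then show ?case by (simp add: split mult.assoc)
qed

text \<open>The same extension argument now acts on the environment variable: with the Dirac kernel
  at \<open>env \<omega>\<close>, the identity for all test sets \<open>E\<close> becomes an
  identity for all nonnegative \<open>h\<close>.\<close>

lemma nn_integral_quenched_prod:
  assumes "finite I" and h: "h \<in> borel_measurable env_space"
    and g: "\<And>z. z \<in> I \<Longrightarrow> g z \<in> borel_measurable borel"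
  shows "(\<integral>\<^sup>+\<omega>. h (env \<omega>) * (\<Prod>z\<in>I. g z (X z \<omega>)) \<partial>M) =
    (\<integral>\<^sup>+\<omega>. h (env \<omega>) * (\<Prod>z\<in>I. \<integral>\<^sup>+x. g z x \<partial>F (snd z) \<omega>) \<partial>M)"
proof -
  note [measurable] = env_sequence_measurable
  have sp: "\<omega> \<in> space M \<Longrightarrow> env \<omega> \<in> space env_space" for \<omega>
    using measurable_space[OF env_sequence_measurable] by blast
  have "(\<integral>\<^sup>+\<omega>. (\<Prod>z\<in>I. g z (X z \<omega>)) * h (env \<omega>) \<partial>M) =
    (\<integral>\<^sup>+\<omega>. (\<Prod>z\<in>I. \<integral>\<^sup>+x. g z x \<partial>F (snd z) \<omega>) * (\<integral>\<^sup>+f. h f \<partial>return env_space (env \<omega>)) \<partial>M)"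
  proof (rule nn_integral_kernel_eqI[OF _ _ env_sequence_measurable _ _ h])
    show "(\<lambda>\<omega>. \<Prod>z\<in>I. g z (X z \<omega>)) \<in> borel_measurable M"
      using measurable_compose[OF weight_measurable g] by (auto intro!: borel_measurable_prod)
    show "(\<lambda>\<omega>. \<Prod>z\<in>I. \<integral>\<^sup>+x. g z x \<partial>F (snd z) \<omega>) \<in> borel_measurable M"
      using env_kernel_measurable[OF g] by (auto intro!: borel_measurable_prod)
    show "(\<lambda>\<omega>. return env_space (env \<omega>)) \<in> M \<rightarrow>\<^sub>M subprob_algebra env_space"
      by (rule measurable_compose[OF env_sequence_measurable return_measurable])
    fix E assume E: "E \<in> sets env_space"
    have "(\<integral>\<^sup>+\<omega>. indicator E (env \<omega>) * (\<Prod>z\<in>I. g z (X z \<omega>)) \<partial>M) =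
        (\<integral>\<^sup>+\<omega>. indicator E (env \<omega>) * (\<Prod>z\<in>I. \<integral>\<^sup>+x. g z x \<partial>F (snd z) \<omega>) \<partial>M)"
      by (rule nn_integral_quenched_prod_aux[OF assms(1) assms(1) _ E g]) auto
    then show "(\<integral>\<^sup>+\<omega>. (\<Prod>z\<in>I. g z (X z \<omega>)) * indicator E (env \<omega>) \<partial>M) =
      (\<integral>\<^sup>+\<omega>. (\<Prod>z\<in>I. \<integral>\<^sup>+x. g z x \<partial>F (snd z) \<omega>) * emeasure (return env_space (env \<omega>)) E \<partial>M)"
      unfolding emeasure_return[OF E] mult.commute[of _ "indicator E _"] .
  qed
  also have "\<dots> = (\<integral>\<^sup>+\<omega>. (\<Prod>z\<in>I. \<integral>\<^sup>+x. g z x \<partial>F (snd z) \<omega>) * h (env \<omega>) \<partial>M)"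
    using nn_integral_return[OF sp h] by (intro nn_integral_cong) simp
  finally show ?thesis by (simp add: mult.commute)
qed

end

section \<open>Lattice paths\<close>

text \<open>Each step raises the sum of the coordinates by one, so no site can be visited
  twice.\<close>

lemma lattice_paths_distinct:
  assumes "p \<in> lattice_paths k l"
  shows "distinct p"
proof -
  have "successively (\<lambda>u v. fst u + snd u < fst v + snd v) p"
    using assms unfolding lattice_paths_def
    by (auto elim!: successively_mono)
  then have "sorted_wrt (<) (map (\<lambda>u. fst u + snd u) p)"
    by (subst (asm) successively_conv_sorted_wrt) (auto intro: transpI simp: sorted_wrt_map)
  then show ?thesis
    by (simp add: strict_sorted_iff distinct_map)
qed

lemma lattice_paths_length: "p \<in> lattice_paths k l \<Longrightarrow> length p = Suc (k + l)"
  using lattice_paths_bound[of p] by (auto simp: lattice_paths_def)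

lemma butlast_lattice_paths:
  assumes "p \<in> lattice_paths k l" and "0 < k + l"
  shows "\<exists>q. p = q @ [(k, l)] \<and>
    (0 < k \<and> q \<in> lattice_paths (k - 1) l \<or> 0 < l \<and> q \<in> lattice_paths k (l - 1))"
proof -
  have p: "p \<noteq> []" "last p = (k, l)" "hd p = (0, 0)"
    "successively (\<lambda>u v. v = (Suc (fst u), snd u) \<or> v = (fst u, Suc (snd u))) p"
    using assms by (auto simp: lattice_paths_def)
  obtain q where q: "p = q @ [(k, l)]"
    using p append_butlast_last_id by metis
  have "q \<noteq> []" using lattice_paths_length[OF assms(1)] assms(2) q by auto
  with p q show ?thesis
    by (cases "last q") (auto simp: successively_append_iff lattice_paths_def)
qed

lemma card_lattice_paths_rec:
  assumes "0 < k + l"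
  shows "card (lattice_paths k l) \<le>
    (if 0 < k then card (lattice_paths (k - 1) l) else 0) +
    (if 0 < l then card (lattice_paths k (l - 1)) else 0)"
proof -
  let ?A = "if 0 < k then lattice_paths (k - 1) l else {}"
  let ?B = "if 0 < l then lattice_paths k (l - 1) else {}"
  have fin: "finite (?A \<union> ?B)" by (simp add: finite_lattice_paths)
  have "lattice_paths k l \<subseteq> (\<lambda>q. q @ [(k, l)]) ` (?A \<union> ?B)"
    using butlast_lattice_paths[OF _ assms] by fastforce
  then have "card (lattice_paths k l) \<le> card (?A \<union> ?B)"
    using fin by (meson card_image_le card_mono finite_imageI order_trans)
  also have "\<dots> \<le> card ?A + card ?B" by (rule card_Un_le)
  finally show ?thesis by (auto split: if_splits)
qed

text \<open>The probability that a random walk with step probabilities \<open>x\<close> and \<open>y\<close> visits \<open>(k, l)\<close>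
  is at most one.\<close>

lemma card_lattice_paths_weight:
  fixes x y :: real
  assumes "0 \<le> x" "0 \<le> y" "x + y \<le> 1"
  shows "card (lattice_paths k l) * x ^ k * y ^ l \<le> 1"
proof (induction "k + l" arbitrary: k l)
  case 0
  have "lattice_paths 0 0 \<subseteq> {[(0, 0)]}"
  proof
    fix p assume p: "p \<in> lattice_paths 0 0"
    from lattice_paths_length[OF p] obtain u where "p = [u]"
      by (auto simp: length_Suc_conv)
    with p show "p \<in> {[(0, 0)]}" by (simp add: lattice_paths_def)
  qed
  then have "card (lattice_paths 0 0) \<le> card {[(0::nat, 0::nat)]}"
    by (intro card_mono) auto
  with 0 show ?case by simp
next
  case (Suc n)
  \<comment> \<open>Split by the last step: the walk arrives from the left with probability
    \<open>x\<close> or from below with probability \<open>y\<close>, and by induction each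
    predecessor is visited with probability at most one.\<close>
  have "real (card (lattice_paths k l)) * x ^ k * y ^ l \<le>
    ((if 0 < k then real (card (lattice_paths (k - 1) l)) else 0) +
     (if 0 < l then real (card (lattice_paths k (l - 1))) else 0)) * x ^ k * y ^ l"
    using card_lattice_paths_rec[of k l] Suc(2) assms
    by (intro mult_right_mono) (auto split: if_splits)
  also have "\<dots> = (if 0 < k then x * (card (lattice_paths (k - 1) l) * x ^ (k - 1) * y ^ l) else 0) +
     (if 0 < l then y * (card (lattice_paths k (l - 1)) * x ^ k * y ^ (l - 1)) else 0)"
    by (cases k; cases l) (auto simp: algebra_simps)
  also have "\<dots> \<le> x + y"
  proof (rule add_mono)
    show "(if 0 < k then x * (card (lattice_paths (k - 1) l) * x ^ (k - 1) * y ^ l) else 0) \<le> x"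
      using Suc(1)[of "k - 1" l] Suc(2) assms(1) by (auto intro!: mult_left_le)
    show "(if 0 < l then y * (card (lattice_paths k (l - 1)) * x ^ k * y ^ (l - 1)) else 0) \<le> y"
      using Suc(1)[of k "l - 1"] Suc(2) assms(2) by (auto intro!: mult_left_le)
  qed
  finally show ?case using assms(3) by linarith
qed

lemma corner_path:
  "map (\<lambda>i. (i, 0)) [0..<k] @ map (\<lambda>j. (k, j)) [0..<l] @ [(k, l)] \<in> lattice_paths k l"
proof -
  have succ: "successively (\<lambda>i j. j = Suc i) [0..<n]" for n
    by (simp add: successively_conv_nth)
  let ?P = "\<lambda>u v. v = (Suc (fst u), snd u) \<or> v = (fst u, Suc (snd u))"
  have 1: "successively ?P (map (\<lambda>i. (i, 0)) [0..<k])"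
    unfolding successively_map by (rule successively_mono[OF succ]) auto
  \<comment> \<open>The column is taken together with the endpoint \<open>(k, l)\<close>, so it is
    nonempty and starts at \<open>(k, 0)\<close> even when \<open>l = 0\<close>.\<close>
  have 2: "successively ?P (map (\<lambda>j. (k, j)) [0..<Suc l])"
    unfolding successively_map by (rule successively_mono[OF succ]) auto
  have hd: "hd (map (\<lambda>j. (k, j)) [0..<Suc l]) = (k, 0)"
    by (simp add: hd_map del: upt_Suc)
  have "successively ?P (map (\<lambda>i. (i, 0)) [0..<k] @ map (\<lambda>j. (k, j)) [0..<Suc l])"
    unfolding successively_append_iff
    using 1 2 hd by (cases k) auto
  moreover have "hd (map (\<lambda>i. (i, 0)) [0..<k] @ map (\<lambda>j. (k, j)) [0..<Suc l]) = (0, 0)"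
    using hd by (cases k) (auto simp: hd_append hd_map simp del: upt_Suc)
  ultimately show ?thesis by (simp add: lattice_paths_def)
qed

text \<open>The path along row 0 and then up column \<open>k\<close> is one competitor in the
  maximum. Its corner \<open>(k, 0)\<close> is counted with the column; for \<open>l = 0\<close> it
  is the excluded endpoint.\<close>

lemma last_passage_ge_corner:
  "(\<Sum>i<k. w (i, 0)) + (\<Sum>j<l. w (k, j)) \<le> last_passage w k l"
proof -
  let ?p = "map (\<lambda>i. (i, 0)) [0..<k] @ map (\<lambda>j. (k, j)) [0..<l] @ [(k, l)]"
  have "(\<Sum>z\<leftarrow>butlast ?p. w z) = (\<Sum>i<k. w (i, 0)) + (\<Sum>j<l. w (k, j))"
    by (simp add: butlast_append comp_def sum_list_distinct_conv_sum_set atLeast0LessThan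
        flip: append_assoc)
  then show ?thesis
    unfolding last_passage_def
    using corner_path[of k l] finite_lattice_paths[of k l]
    by (metis (mono_tags, lifting) Max_ge finite_imageI imageI)
qed

lemma last_passage_attained:
  obtains p where "p \<in> lattice_paths k l" "last_passage w k l = (\<Sum>z\<leftarrow>butlast p. w z)"
proof -
  have "last_passage w k l \<in> (\<lambda>p. \<Sum>z\<leftarrow>butlast p. w z) ` lattice_paths k l"
    unfolding last_passage_def
    by (rule Max_in) (simp_all add: finite_lattice_paths lattice_paths_nonempty)
  then show thesis using that by auto
qed

text \<open>Since a path has no repeated site, its list sum is a sum over a finite set of
  \<open>k + l\<close> sites, which is the form in which conditional independence is
  available.\<close>

lemma path_sum_eq_sum_set:
  assumes "p \<in> lattice_paths k l"
  shows "(\<Sum>z\<leftarrow>butlast p. w z) = (\<Sum>z\<in>set (butlast p). w z)" "card (set (butlast p)) = k + l"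
  using lattice_paths_distinct[OF assms] lattice_paths_length[OF assms]
  by (simp_all add: sum_list_distinct_conv_sum_set distinct_butlast distinct_card)

section \<open>Moments of the weights\<close>

text \<open>Second-order Taylor expansion; the intermediate point of the remainder is at most
  \<bar>y\<bar> in absolute value.\<close>

lemma exp_le_quadratic:
  fixes y :: real
  shows "exp y \<le> 1 + y + y\<^sup>2 / 2 * exp \<bar>y\<bar>"
proof -
  obtain t where t: "\<bar>t\<bar> \<le> \<bar>y\<bar>" "exp y = (\<Sum>m<2. y ^ m / fact m) + exp t / fact 2 * y ^ 2"
    using Maclaurin_exp_le[of y 2] by blast
  have "exp t * y\<^sup>2 \<le> exp \<bar>y\<bar> * y\<^sup>2"
    using t(1) by (intro mult_right_mono) auto
  with t(2) show ?thesis
    by (simp add: eval_nat_numeral mult.commute)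
qed

text \<open>Centring removes the linear term of the expansion, and the exponential moment at
  \<open>t\<close> controls the quadratic remainder as long as \<theta> is at most half of
  \<open>t\<close>. What remains is of order \<theta> squared, with a constant that depends on
  \<open>K\<close> and \<open>t\<close> only.\<close>

lemma nn_integral_exp_centered_le:
  fixes G :: "real measure" and \<theta> t K :: real
  assumes "prob_space G" and sets: "sets G = sets borel"
    and "0 < t" and \<theta>: "0 \<le> \<theta>" "\<theta> \<le> t / 2" and "0 \<le> K"
    and K: "(\<integral>\<^sup>+x. ennreal (exp (t * \<bar>x - dist_mean G\<bar>)) \<partial>G) \<le> ennreal K"
  shows "(\<integral>\<^sup>+x. ennreal (exp (\<theta> * (x - dist_mean G))) \<partial>G) \<le> ennreal (exp (4 * K / t\<^sup>2 * \<theta>\<^sup>2))"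
proof -
  interpret prob_space G by fact
  define m where "m = dist_mean G"
  note [measurable_cong] = sets
  have exp_int: "integrable G (\<lambda>x. exp (t * \<bar>x - m\<bar>))"
  proof (rule integrableI_bounded)
    show "(\<lambda>x. exp (t * \<bar>x - m\<bar>)) \<in> borel_measurable G" by measurable
    show "(\<integral>\<^sup>+x. ennreal (norm (exp (t * \<bar>x - m\<bar>))) \<partial>G) < \<infinity>"
      using K by (auto simp: m_def intro: le_less_trans)
  qed
  have exp_le: "(\<integral>x. exp (t * \<bar>x - m\<bar>) \<partial>G) \<le> K"
    using K \<open>0 \<le> K\<close> by (simp add: nn_integral_eq_integral[OF exp_int, unfolded m_def] m_def)
  have cent_int: "integrable G (\<lambda>x. x - m)"
  proof (rule Bochner_Integration.integrable_bound)
    show "integrable G (\<lambda>x. exp (t * \<bar>x - m\<bar>) / t)" using exp_int by simp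
    show "(\<lambda>x. x - m) \<in> borel_measurable G" by measurable
    have "t * \<bar>u\<bar> \<le> exp (t * \<bar>u\<bar>)" for u :: real
      using exp_ge_add_one_self[of "t * \<bar>u\<bar>"] by linarith
    then show "AE x in G. norm (x - m) \<le> norm (exp (t * \<bar>x - m\<bar>) / t)"
      using \<open>0 < t\<close> by (intro AE_I2) (simp add: field_simps)
  qed
  then have "integrable G (\<lambda>x. (x - m) + m)" by (intro Bochner_Integration.integrable_add) auto
  \<comment> \<open>This guarantees that \<open>dist_mean G\<close> is the true mean, not the
    default value 0 of the integral of a non-integrable function.\<close>
  then have id_int: "integrable G (\<lambda>x. x)" by simp
  have zero: "(\<integral>x. x - m \<partial>G) = 0"
    using id_int by (simp add: m_def dist_mean_def prob_space)
  let ?f = "\<lambda>x. 1 + \<theta> * (x - m) + 4 * \<theta>\<^sup>2 / t\<^sup>2 * exp (t * \<bar>x - m\<bar>)"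
  have f_int: "integrable G ?f"
    using cent_int exp_int by simp
  have pointwise: "exp (\<theta> * u) \<le> 1 + \<theta> * u + 4 * \<theta>\<^sup>2 / t\<^sup>2 * exp (t * \<bar>u\<bar>)" for u :: real
  proof -
    \<comment> \<open>The exponent \<open>t * \<bar>u\<bar>\<close> is divided into halves: one
      absorbs the factor \<open>u\<^sup>2\<close> at the price \<open>8 / t\<^sup>2\<close>, the
      other dominates the exponential in the remainder.\<close>
    have "(t * \<bar>u\<bar> / 2)\<^sup>2 / 2 \<le> exp (t * \<bar>u\<bar> / 2)"
      using exp_lower_Taylor_quadratic[of "t * \<bar>u\<bar> / 2"] mult_nonneg_nonneg[of t "\<bar>u\<bar>"] \<open>0 < t\<close> by linarith
    then have 1: "u\<^sup>2 \<le> 8 / t\<^sup>2 * exp (t * \<bar>u\<bar> / 2)"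
      using \<open>0 < t\<close> by (simp add: power2_eq_square field_simps)
    have 2: "exp \<bar>\<theta> * u\<bar> \<le> exp (t * \<bar>u\<bar> / 2)"
      using \<theta> by (simp add: abs_mult) (use mult_right_mono[of \<theta> "t / 2" "\<bar>u\<bar>"] in simp)
    have "u\<^sup>2 * exp \<bar>\<theta> * u\<bar> \<le> (8 / t\<^sup>2 * exp (t * \<bar>u\<bar> / 2)) * exp (t * \<bar>u\<bar> / 2)"
      using 1 2 by (intro mult_mono) auto
    also have "\<dots> = 8 / t\<^sup>2 * exp (t * \<bar>u\<bar>)"
      by (simp flip: exp_add)
    finally have "\<theta>\<^sup>2 / 2 * (u\<^sup>2 * exp \<bar>\<theta> * u\<bar>) \<le> \<theta>\<^sup>2 / 2 * (8 / t\<^sup>2 * exp (t * \<bar>u\<bar>))"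
      by (intro mult_left_mono) auto
    with exp_le_quadratic[of "\<theta> * u"] show ?thesis
      by (simp add: power_mult_distrib algebra_simps)
  qed
  have "(\<integral>\<^sup>+x. ennreal (exp (\<theta> * (x - m))) \<partial>G) \<le> (\<integral>\<^sup>+x. ennreal (?f x) \<partial>G)"
    by (intro nn_integral_mono ennreal_leI pointwise)
  also have "\<dots> = ennreal (\<integral>x. ?f x \<partial>G)"
    using pointwise exp_ge_zero order_trans by (intro nn_integral_eq_integral f_int AE_I2) blast
  also have "(\<integral>x. ?f x \<partial>G) = 1 + 4 * \<theta>\<^sup>2 / t\<^sup>2 * (\<integral>x. exp (t * \<bar>x - m\<bar>) \<partial>G)"
    using cent_int exp_int zero by (simp add: prob_space)
  also have "\<dots> \<le> 1 + 4 * \<theta>\<^sup>2 / t\<^sup>2 * K"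
    using exp_le by (intro add_left_mono mult_left_mono) auto
  also have "\<dots> \<le> exp (4 * K / t\<^sup>2 * \<theta>\<^sup>2)"
    using exp_ge_add_one_self[of "4 * K / t\<^sup>2 * \<theta>\<^sup>2"] by (simp add: algebra_simps)
  finally show ?thesis by (simp add: m_def ennreal_leI)
qed

section \<open>Functionals of a single row and moments of a single weight\<close>

lemma dist_mean_measurable: "dist_mean \<in> borel_measurable (prob_algebra borel)"
proof -
  have [measurable]: "(\<lambda>G. G) \<in> prob_algebra borel \<rightarrow>\<^sub>M subprob_algebra (borel :: real measure)"
    by (rule measurable_prob_algebraD) simp
  have "(\<lambda>G. \<integral>x. x \<partial>G) \<in> borel_measurable (prob_algebra (borel :: real measure))"
    by measurable
  then show ?thesis by (simp add: dist_mean_def[abs_def])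
qed

lemma nn_integral_measurable_prob_algebra:
  assumes "(\<lambda>(G, x). f G x) \<in> borel_measurable (prob_algebra borel \<Otimes>\<^sub>M (borel :: real measure))"
  shows "(\<lambda>G. \<integral>\<^sup>+x. f G x \<partial>G) \<in> borel_measurable (prob_algebra borel)"
  by (rule nn_integral_measurable_subprob_algebra2[OF assms measurable_prob_algebraD]) simp

context random_environment
begin

lemma nn_integral_env_eq:
  assumes "iid_environment M F" and "f \<in> borel_measurable (prob_algebra borel)"
  shows "(\<integral>\<^sup>+\<omega>. f (F j \<omega>) \<partial>M) = (\<integral>\<^sup>+\<omega>. f (F 0 \<omega>) \<partial>M)"
proof -
  have "(\<integral>\<^sup>+\<omega>. f (F i \<omega>) \<partial>M) = (\<integral>\<^sup>+G. f G \<partial>distr M (prob_algebra borel) (F i))" for i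
    using assms(2) env_measurable[of i] by (simp add: nn_integral_distr)
  moreover have "distr M (prob_algebra borel) (F j) = distr M (prob_algebra borel) (F 0)"
    using assms(1) unfolding iid_environment_def by blast
  ultimately show ?thesis by simp
qed

text \<open>The bounds on means and exponential moments are assumed for row 0; equality of the row
  laws moves them to every row.\<close>

lemma AE_env_eq:
  assumes "iid_environment M F" and "{G \<in> space (prob_algebra borel). P G} \<in> sets (prob_algebra borel)"
    and "AE \<omega> in M. P (F 0 \<omega>)"
  shows "AE \<omega> in M. P (F j \<omega>)"
proof -
  have "(AE \<omega> in M. P (F i \<omega>)) = (AE G in distr M (prob_algebra borel) (F i). P G)" for i
    by (rule AE_distr_iff[OF env_measurable assms(2), symmetric])
  moreover have "distr M (prob_algebra borel) (F j) = distr M (prob_algebra borel) (F 0)"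
    using assms(1) unfolding iid_environment_def by blast
  ultimately show ?thesis using assms(3) by metis
qed

text \<open>The tested row \<open>i\<close> need not be the row of \<open>z\<close>: the lower bound
  tests row 0 against sites both in row 0 and above it.\<close>

lemma nn_integral_weight:
  assumes [measurable]: "f \<in> borel_measurable borel" and E: "E \<in> sets (prob_algebra borel)"
  shows "(\<integral>\<^sup>+\<omega>. indicator E (F i \<omega>) * f (X z \<omega>) \<partial>M) =
    (\<integral>\<^sup>+\<omega>. indicator E (F i \<omega>) * (\<integral>\<^sup>+x. f x \<partial>F (snd z) \<omega>) \<partial>M)"
proof -
  note [measurable] = E
  have "(\<lambda>f. indicator E (f i) :: ennreal) \<in> borel_measurable env_space" by measurable
  from nn_integral_quenched_prod[OF _ this, of "{z}" "\<lambda>_. f"] show ?thesis by simp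
qed

lemma nn_integral_weight_law:
  assumes iid: "iid_environment M F" and f: "f \<in> borel_measurable borel"
  shows "(\<integral>\<^sup>+\<omega>. f (X z \<omega>) \<partial>M) = (\<integral>\<^sup>+\<omega>. \<integral>\<^sup>+x. f x \<partial>F 0 \<omega> \<partial>M)"
proof -
  note [measurable] = f
  have "(\<integral>\<^sup>+\<omega>. f (X z \<omega>) \<partial>M) = (\<integral>\<^sup>+\<omega>. (\<integral>\<^sup>+x. f x \<partial>F (snd z) \<omega>) \<partial>M)"
    using nn_integral_weight[OF f sets.top, of 0 z] measurable_space[OF env_measurable, of _ 0]
    by (simp cong: nn_integral_cong)
  also have "\<dots> = (\<integral>\<^sup>+\<omega>. (\<integral>\<^sup>+x. f x \<partial>F 0 \<omega>) \<partial>M)"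
    by (rule nn_integral_env_eq[OF iid nn_integral_measurable_prob_algebra]) measurable
  finally show ?thesis .
qed

text \<open>Given the environment, \<open>f (X z)\<close> may be replaced by its average under row
  \<open>snd z\<close>, and this is a function of a row independent of row \<open>i\<close>.\<close>

lemma nn_integral_weight_independent_row:
  assumes iid: "iid_environment M F" and f: "f \<in> borel_measurable borel"
    and E: "E \<in> sets (prob_algebra borel)" and "i \<noteq> snd z"
  shows "(\<integral>\<^sup>+\<omega>. indicator E (F i \<omega>) * f (X z \<omega>) \<partial>M) =
    (\<integral>\<^sup>+\<omega>. indicator E (F i \<omega>) \<partial>M) * (\<integral>\<^sup>+\<omega>. f (X z \<omega>) \<partial>M)"
proof -
  note [measurable] = f E
  let ?a = "\<lambda>G. \<integral>\<^sup>+x. f x \<partial>G"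
  let ?h = "\<lambda>j. if j = i then indicator E else ?a"
  have a: "?a \<in> borel_measurable (prob_algebra borel)"
    by (rule nn_integral_measurable_prob_algebra) measurable
  have "indep_vars (\<lambda>_. prob_algebra borel) F {i, snd z}"
    using iid indep_vars_subset unfolding iid_environment_def by blast
  then have "indep_vars (\<lambda>_. borel) (\<lambda>j \<omega>. ?h j (F j \<omega>)) {i, snd z}"
    by (rule indep_vars_compose2) (use a in auto)
  then have "(\<integral>\<^sup>+\<omega>. (\<Prod>j\<in>{i, snd z}. ?h j (F j \<omega>)) \<partial>M) = (\<Prod>j\<in>{i, snd z}. \<integral>\<^sup>+\<omega>. ?h j (F j \<omega>) \<partial>M)"
    by (intro indep_vars_nn_integral) auto
  then have "(\<integral>\<^sup>+\<omega>. indicator E (F i \<omega>) * ?a (F (snd z) \<omega>) \<partial>M) =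
      (\<integral>\<^sup>+\<omega>. indicator E (F i \<omega>) \<partial>M) * (\<integral>\<^sup>+\<omega>. ?a (F (snd z) \<omega>) \<partial>M)"
    using \<open>i \<noteq> snd z\<close> by simp
  moreover have "(\<integral>\<^sup>+\<omega>. ?a (F (snd z) \<omega>) \<partial>M) = (\<integral>\<^sup>+\<omega>. f (X z \<omega>) \<partial>M)"
    using nn_integral_weight_law[OF iid f] nn_integral_env_eq[OF iid a] by simp
  ultimately show ?thesis using nn_integral_weight[OF f E] by simp
qed

text \<open>For signed weights the positive and negative parts are averaged separately and then
  subtracted. The conditional absolute moment has finite integral, so almost surely both parts are
  finite and their difference is the row mean.\<close>

lemma expectation_weight:
  assumes int: "integrable M (X z)" and E: "E \<in> sets (prob_algebra borel)"
  shows "integrable M (\<lambda>\<omega>. indicator E (F i \<omega>) * dist_mean (F (snd z) \<omega>))"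
    and "expectation (\<lambda>\<omega>. indicator E (F i \<omega>) * X z \<omega>) =
      expectation (\<lambda>\<omega>. indicator E (F i \<omega>) * dist_mean (F (snd z) \<omega>))"
proof -
  note [measurable] = E env_measurable[of i] weight_measurable
  let ?G = "F (snd z)"
  let ?one = "\<lambda>\<omega>. indicator E (F i \<omega>) :: real"
  let ?P = "\<lambda>\<omega>. \<integral>\<^sup>+x. ennreal x \<partial>?G \<omega>" and ?N = "\<lambda>\<omega>. \<integral>\<^sup>+x. ennreal (- x) \<partial>?G \<omega>"
  let ?A = "\<lambda>\<omega>. \<integral>\<^sup>+x. ennreal \<bar>x\<bar> \<partial>?G \<omega>"
  have [measurable]: "?P \<in> borel_measurable M" "?N \<in> borel_measurable M" "?A \<in> borel_measurable M"
    by (rule env_kernel_measurable, simp)+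
  have "(\<integral>\<^sup>+\<omega>. ?A \<omega> \<partial>M) = (\<integral>\<^sup>+\<omega>. ennreal \<bar>X z \<omega>\<bar> \<partial>M)"
    using nn_integral_weight[OF _ sets.top, of "\<lambda>x. ennreal \<bar>x\<bar>" i z]
      measurable_space[OF env_measurable, of _ i]
    by (simp cong: nn_integral_cong)
  also have "\<dots> < \<infinity>" using int by (simp add: integrable_iff_bounded)
  finally have A_fin: "(\<integral>\<^sup>+\<omega>. ?A \<omega> \<partial>M) < \<infinity>" .
  then have A_AE: "AE \<omega> in M. ?A \<omega> \<noteq> \<infinity>"
    by (intro nn_integral_PInf_AE) auto
  have bound: "?P \<omega> \<le> ?A \<omega>" "?N \<omega> \<le> ?A \<omega>" for \<omega>
    by (intro nn_integral_mono ennreal_leI; simp)+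
  \<comment> \<open>Here \<open>Q\<close> stands for \<open>?P\<close> or \<open>?N\<close>.
    Domination by \<open>?A\<close> makes it almost surely finite, so that \<open>enn2real\<close>
    loses nothing.\<close>
  have key: "integrable M (\<lambda>\<omega>. ?one \<omega> * enn2real (Q \<omega>))"
      "enn2real (\<integral>\<^sup>+\<omega>. indicator E (F i \<omega>) * Q \<omega> \<partial>M) = expectation (\<lambda>\<omega>. ?one \<omega> * enn2real (Q \<omega>))"
    if [measurable]: "Q \<in> borel_measurable M" and Q: "\<And>\<omega>. Q \<omega> \<le> ?A \<omega>" for Q
  proof -
    have "AE \<omega> in M. Q \<omega> < \<infinity>"
      using A_AE by eventually_elim (use Q in \<open>auto simp: less_top intro: le_less_trans\<close>)
    then have eq: "AE \<omega> in M. ennreal (?one \<omega> * enn2real (Q \<omega>)) = indicator E (F i \<omega>) * Q \<omega>"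
      by eventually_elim (auto simp: indicator_def)
    have "(\<integral>\<^sup>+\<omega>. ennreal (?one \<omega> * enn2real (Q \<omega>)) \<partial>M) = (\<integral>\<^sup>+\<omega>. indicator E (F i \<omega>) * Q \<omega> \<partial>M)"
      using eq by (rule nn_integral_cong_AE)
    moreover have "(\<integral>\<^sup>+\<omega>. indicator E (F i \<omega>) * Q \<omega> \<partial>M) \<le> (\<integral>\<^sup>+\<omega>. ?A \<omega> \<partial>M)"
      using Q by (intro nn_integral_mono) (auto simp: indicator_def)
    ultimately show int: "integrable M (\<lambda>\<omega>. ?one \<omega> * enn2real (Q \<omega>))"
      using A_fin by (intro integrableI_nonneg) (auto intro: le_less_trans)
    show "enn2real (\<integral>\<^sup>+\<omega>. indicator E (F i \<omega>) * Q \<omega> \<partial>M) = expectation (\<lambda>\<omega>. ?one \<omega> * enn2real (Q \<omega>))"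
      by (subst nn_integral_cong_AE[OF eq, symmetric], subst integral_eq_nn_integral) auto
  qed
  have mean: "AE \<omega> in M. ?one \<omega> * dist_mean (?G \<omega>) = ?one \<omega> * enn2real (?P \<omega>) - ?one \<omega> * enn2real (?N \<omega>)"
    using A_AE AE_space
  proof (eventually_elim, goal_cases)
    case (1 \<omega>)
    have "integrable (?G \<omega>) (\<lambda>x. x)"
    proof (rule integrableI_bounded)
      show "(\<lambda>x. x) \<in> borel_measurable (?G \<omega>)"
        using 1(2) by (rule env_borel_measurable) simp
    qed (use 1 in \<open>simp add: less_top\<close>)
    then show ?case
      unfolding dist_mean_def by (simp add: real_lebesgue_integral_def right_diff_distrib)
  qed
  show int_mean: "integrable M (\<lambda>\<omega>. ?one \<omega> * dist_mean (?G \<omega>))"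
    using mean key(1)[of ?P] key(1)[of ?N] bound dist_mean_env_measurable[of "snd z"]
    by (subst integrable_cong_AE[where g = "\<lambda>\<omega>. ?one \<omega> * enn2real (?P \<omega>) - ?one \<omega> * enn2real (?N \<omega>)"])
       (auto intro!: Bochner_Integration.integrable_diff)
  have "integrable M (\<lambda>\<omega>. ?one \<omega> * X z \<omega>)"
    by (rule Bochner_Integration.integrable_bound[OF int]) (auto simp: indicator_def)
  then have "expectation (\<lambda>\<omega>. ?one \<omega> * X z \<omega>) =
      enn2real (\<integral>\<^sup>+\<omega>. ennreal (?one \<omega> * X z \<omega>) \<partial>M) - enn2real (\<integral>\<^sup>+\<omega>. ennreal (- (?one \<omega> * X z \<omega>)) \<partial>M)"
    by (rule real_lebesgue_integral_def)
  also have "(\<integral>\<^sup>+\<omega>. ennreal (?one \<omega> * X z \<omega>) \<partial>M) = (\<integral>\<^sup>+\<omega>. indicator E (F i \<omega>) * ennreal (X z \<omega>) \<partial>M)"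
    by (intro nn_integral_cong) (auto simp: indicator_def)
  also have "\<dots> = (\<integral>\<^sup>+\<omega>. indicator E (F i \<omega>) * ?P \<omega> \<partial>M)"
    by (rule nn_integral_weight[OF _ E]) simp
  also have "(\<integral>\<^sup>+\<omega>. ennreal (- (?one \<omega> * X z \<omega>)) \<partial>M) = (\<integral>\<^sup>+\<omega>. indicator E (F i \<omega>) * ennreal (- X z \<omega>) \<partial>M)"
    by (intro nn_integral_cong) (auto simp: indicator_def)
  also have "\<dots> = (\<integral>\<^sup>+\<omega>. indicator E (F i \<omega>) * ?N \<omega> \<partial>M)"
    by (rule nn_integral_weight[OF _ E, of "\<lambda>x. ennreal (- x)"]) simp
  finally have "expectation (\<lambda>\<omega>. ?one \<omega> * X z \<omega>) =
      expectation (\<lambda>\<omega>. ?one \<omega> * enn2real (?P \<omega>) - ?one \<omega> * enn2real (?N \<omega>))"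
    using key[of ?P] key[of ?N] bound by simp
  also have "\<dots> = expectation (\<lambda>\<omega>. ?one \<omega> * dist_mean (?G \<omega>))"
    using mean dist_mean_env_measurable[of "snd z"] by (intro integral_cong_AE) auto
  finally show "expectation (\<lambda>\<omega>. ?one \<omega> * X z \<omega>) = expectation (\<lambda>\<omega>. ?one \<omega> * dist_mean (?G \<omega>))" .
qed


text \<open>The row means depend on the environment alone, so the exponential splits into an
  environment factor and a product over the weights. Averaging the weights out leaves one centred
  exponential moment, at most \<kappa>, for each site.\<close>

lemma nn_integral_exp_centered_sum_le:
  assumes I: "finite I"
    and mom: "AE \<omega> in M. \<forall>j. (\<integral>\<^sup>+x. ennreal (exp (\<theta> * (x - dist_mean (F j \<omega>)))) \<partial>F j \<omega>) \<le> \<kappa>"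
  shows "(\<integral>\<^sup>+\<omega>. ennreal (exp (\<theta> * (\<Sum>z\<in>I. X z \<omega> - dist_mean (F (snd z) \<omega>)))) \<partial>M) \<le> \<kappa> ^ card I"
proof -
  note [measurable] = dist_mean_measurable
  let ?h = "\<lambda>f. \<Prod>z\<in>I. ennreal (exp (- \<theta> * dist_mean (f (snd z))))"
  let ?g = "\<lambda>x. ennreal (exp (\<theta> * x))"
  have h: "?h \<in> borel_measurable env_space" by measurable
  have split: "ennreal (exp (\<theta> * (x - m))) = ennreal (exp (- \<theta> * m)) * ?g x" for x m
    by (simp add: ennreal_mult[symmetric] exp_add[symmetric] algebra_simps)
  have "(\<integral>\<^sup>+\<omega>. ennreal (exp (\<theta> * (\<Sum>z\<in>I. X z \<omega> - dist_mean (F (snd z) \<omega>)))) \<partial>M) =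
      (\<integral>\<^sup>+\<omega>. ?h (env \<omega>) * (\<Prod>z\<in>I. ?g (X z \<omega>)) \<partial>M)"
    using I by (intro nn_integral_cong)
      (simp add: sum_distrib_left exp_sum prod_ennreal[symmetric] split prod.distrib)
  also have "\<dots> = (\<integral>\<^sup>+\<omega>. ?h (env \<omega>) * (\<Prod>z\<in>I. \<integral>\<^sup>+x. ?g x \<partial>F (snd z) \<omega>) \<partial>M)"
    by (rule nn_integral_quenched_prod[OF I h]) simp
  also have "\<dots> \<le> (\<integral>\<^sup>+\<omega>. \<kappa> ^ card I \<partial>M)"
  proof (rule nn_integral_mono_AE, use mom AE_space in eventually_elim, goal_cases)
    case (1 \<omega>)
    have "ennreal (exp (- \<theta> * dist_mean (F j \<omega>))) * (\<integral>\<^sup>+x. ?g x \<partial>F j \<omega>) \<le> \<kappa>" for j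
    proof -
      have "?g \<in> borel_measurable (F j \<omega>)"
        using 1(2) by (rule env_borel_measurable) simp
      then have "ennreal (exp (- \<theta> * dist_mean (F j \<omega>))) * (\<integral>\<^sup>+x. ?g x \<partial>F j \<omega>) =
          (\<integral>\<^sup>+x. ennreal (exp (\<theta> * (x - dist_mean (F j \<omega>)))) \<partial>F j \<omega>)"
        by (simp only: split nn_integral_cmult)
      with 1 show ?thesis by simp
    qed
    then have "(\<Prod>z\<in>I. ennreal (exp (- \<theta> * dist_mean (F (snd z) \<omega>))) * (\<integral>\<^sup>+x. ?g x \<partial>F (snd z) \<omega>)) \<le> (\<Prod>z\<in>I. \<kappa>)"
      by (intro prod_mono_ennreal) auto
    then show ?case by (simp add: prod.distrib)
  qed
  also have "\<dots> = \<kappa> ^ card I" by (simp add: emeasure_space_1)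
  finally show ?thesis .
qed

section \<open>Integrability of the last-passage time and a bound on its mean\<close>

lemma last_passage_measurable: "(\<lambda>\<omega>. last_passage (\<lambda>z. X z \<omega>) k l) \<in> borel_measurable M"
proof -
  have "(\<lambda>\<omega>. \<Sum>z\<leftarrow>p. X z \<omega>) \<in> borel_measurable M" for p
    using weight_measurable by (induction p) auto
  then show ?thesis
    unfolding last_passage_def by (intro borel_measurable_Max finite_lattice_paths)
qed

text \<open>The maximum is attained by some path, so its absolute value is at most the sum of the
  absolute path sums over the finitely many paths.\<close>

lemma last_passage_integrable:
  assumes "\<And>z. integrable M (X z)"
  shows "integrable M (\<lambda>\<omega>. last_passage (\<lambda>z. X z \<omega>) k l)"
proof (rule Bochner_Integration.integrable_bound)
  let ?S = "\<lambda>p \<omega>. \<Sum>z\<leftarrow>butlast p. X z \<omega>"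
  have "integrable M (\<lambda>\<omega>. \<Sum>z\<leftarrow>p. X z \<omega>)" for p
    using assms by (induction p) auto
  then show "integrable M (\<lambda>\<omega>. \<Sum>p\<in>lattice_paths k l. \<bar>?S p \<omega>\<bar>)" by simp
  have "\<bar>last_passage (\<lambda>z. X z \<omega>) k l\<bar> \<le> (\<Sum>p\<in>lattice_paths k l. \<bar>?S p \<omega>\<bar>)" for \<omega>
  proof -
    obtain p where "p \<in> lattice_paths k l" "last_passage (\<lambda>z. X z \<omega>) k l = ?S p \<omega>"
      by (rule last_passage_attained)
    then show ?thesis
      using member_le_sum[of p "lattice_paths k l" "\<lambda>p. \<bar>?S p \<omega>\<bar>"] finite_lattice_paths by simp
  qed
  then show "AE \<omega> in M. norm (last_passage (\<lambda>z. X z \<omega>) k l) \<le> norm (\<Sum>p\<in>lattice_paths k l. \<bar>?S p \<omega>\<bar>)"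
    by (intro AE_I2) (simp add: sum_nonneg)
qed (rule last_passage_measurable)

text \<open>The exponential of the maximal centred path sum is at most the sum \<open>V\<close> over
  all paths, whose expectation is the number of paths times a power of \<open>exp \<kappa>\<close>.
  The walk probabilities \<open>x\<close> and \<open>y\<close> are left free, to be matched to the
  direction later.\<close>

lemma expectation_last_passage_le:
  assumes int: "\<And>z. integrable M (X z)"
    and mom: "AE \<omega> in M. \<forall>j. (\<integral>\<^sup>+x. ennreal (exp (\<theta> * (x - dist_mean (F j \<omega>)))) \<partial>F j \<omega>) \<le> ennreal (exp \<kappa>)"
    and mean: "AE \<omega> in M. \<forall>j. dist_mean (F j \<omega>) \<le> m"
    and pos: "0 < \<theta>" "0 < x" "0 < y" "x + y \<le> 1"
  shows "expectation (\<lambda>\<omega>. last_passage (\<lambda>z. X z \<omega>) k l) \<le>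
    (k + l) * m + (\<kappa> * (k + l) - k * ln x - l * ln y) / \<theta>"
proof -
  let ?T = "\<lambda>\<omega>. last_passage (\<lambda>z. X z \<omega>) k l"
  let ?L = "lattice_paths k l"
  define W where "W p \<omega> = (\<Sum>z\<in>set (butlast p). X z \<omega> - dist_mean (F (snd z) \<omega>))" for p \<omega>
  define V where "V \<omega> = (\<Sum>p\<in>?L. exp (\<theta> * W p \<omega>))" for \<omega>
  \<comment> \<open>The logarithm of the bound on the expectation of \<open>V\<close>: the first
    term comes from the \<open>k + l\<close> site moments, the other two from the path
    count.\<close>
  define b where "b = \<kappa> * (k + l) - k * ln x - l * ln y"
  note [measurable] = weight_measurable dist_mean_env_measurable
  have W_meas [measurable]: "W p \<in> borel_measurable M" for p
    unfolding W_def by measurable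
  have V_meas [measurable]: "V \<in> borel_measurable M"
    unfolding V_def by measurable
  have card_le: "card ?L * exp \<kappa> ^ (k + l) \<le> exp b"
  proof -
    have "exp b = exp (real (k + l) * \<kappa>) / (exp (real k * ln x) * exp (real l * ln y))"
      by (simp add: b_def exp_diff mult.commute)
    then have "exp b = exp \<kappa> ^ (k + l) / (x ^ k * y ^ l)"
      using pos unfolding exp_of_nat_mult by simp
    moreover have "card ?L \<le> 1 / (x ^ k * y ^ l)"
      using card_lattice_paths_weight[of x y k l] pos by (simp add: field_simps)
    ultimately show ?thesis
      using mult_right_mono[of "real (card ?L)" "1 / (x ^ k * y ^ l)" "exp \<kappa> ^ (k + l)"] by simp
  qed
  have "(\<integral>\<^sup>+\<omega>. ennreal (V \<omega>) \<partial>M) = (\<Sum>p\<in>?L. \<integral>\<^sup>+\<omega>. ennreal (exp (\<theta> * W p \<omega>)) \<partial>M)"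
    unfolding V_def by (subst nn_integral_sum[symmetric]) (auto simp: sum_ennreal)
  also have "\<dots> \<le> (\<Sum>p\<in>?L. ennreal (exp \<kappa> ^ (k + l)))"
  proof (rule sum_mono)
    fix p assume p: "p \<in> ?L"
    show "(\<integral>\<^sup>+\<omega>. ennreal (exp (\<theta> * W p \<omega>)) \<partial>M) \<le> ennreal (exp \<kappa> ^ (k + l))"
      using nn_integral_exp_centered_sum_le[OF _ mom, of "set (butlast p)"] path_sum_eq_sum_set(2)[OF p]
      by (simp add: W_def ennreal_power)
  qed
  also have "\<dots> = ennreal (card ?L * exp \<kappa> ^ (k + l))"
    by (simp add: ennreal_mult ennreal_of_nat_eq_real_of_nat)
  also have "\<dots> \<le> ennreal (exp b)" using card_le by (rule ennreal_leI)
  finally have V_nn: "(\<integral>\<^sup>+\<omega>. ennreal (V \<omega>) \<partial>M) \<le> ennreal (exp b)" .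
  have V_nonneg: "0 \<le> V \<omega>" for \<omega> unfolding V_def by (intro sum_nonneg) simp
  have V_int: "integrable M V"
    using V_nn V_nonneg by (intro integrableI_nonneg) (auto intro: le_less_trans)
  have V_le: "expectation V \<le> exp b"
    using V_nn V_nonneg nn_integral_eq_integral[OF V_int] by simp
  \<comment> \<open>Subtracting \<open>b\<close> normalises the exponential moment of
    \<open>?u\<close> to at most one. The inequality \<open>1 + u \<le> exp u\<close> then shows
    that \<open>?u\<close> has nonpositive expectation, so Jensen's inequality is not called
    for.\<close>
  let ?u = "\<lambda>\<omega>. \<theta> * (?T \<omega> - (k + l) * m) - b"
  have T_int: "integrable M ?T" by (rule last_passage_integrable[OF int])
  have "AE \<omega> in M. 1 + ?u \<omega> \<le> exp (- b) * V \<omega>"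
    using mean
  proof eventually_elim
    case (elim \<omega>)
    obtain p where p: "p \<in> ?L" and T: "?T \<omega> = (\<Sum>z\<leftarrow>butlast p. X z \<omega>)"
      by (rule last_passage_attained)
    have "(\<Sum>z\<in>set (butlast p). dist_mean (F (snd z) \<omega>)) \<le> (\<Sum>z\<in>set (butlast p). m)"
      using elim by (intro sum_mono) auto
    then have "?T \<omega> - (k + l) * m \<le> W p \<omega>"
      unfolding T path_sum_eq_sum_set(1)[OF p]
      using path_sum_eq_sum_set(2)[OF p] by (simp add: W_def sum_subtractf)
    then have "\<theta> * (?T \<omega> - (k + l) * m) \<le> \<theta> * W p \<omega>"
      using pos by (intro mult_left_mono) auto
    moreover have "exp (\<theta> * W p \<omega>) \<le> V \<omega>"
      unfolding V_def using p finite_lattice_paths by (intro member_le_sum) auto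
    moreover have "1 + ?u \<omega> \<le> exp (- b) * exp (\<theta> * (?T \<omega> - (k + l) * m))"
      using exp_ge_add_one_self[of "?u \<omega>"] by (simp add: exp_add[symmetric])
    ultimately show ?case
      by (smt (verit) exp_le_cancel_iff exp_gt_zero mult_left_mono)
  qed
  then have "expectation (\<lambda>\<omega>. 1 + ?u \<omega>) \<le> expectation (\<lambda>\<omega>. exp (- b) * V \<omega>)"
    using T_int V_int by (intro integral_mono_AE) auto
  also have "\<dots> \<le> exp (- b) * exp b"
    using V_le by simp
  also have "\<dots> = 1" by (simp add: exp_minus)
  finally have "\<theta> * (expectation ?T - (k + l) * m) \<le> b"
    using T_int by (simp add: prob_space)
  then show ?thesis
    using pos unfolding b_def by (simp add: field_simps)
qed

section \<open>Passage to the limit shape and its lower bound\<close>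

lemma scaled_passage_integrable:
  "(\<And>z. integrable M (X z)) \<Longrightarrow> integrable M (scaled_passage X x y n)"
  unfolding scaled_passage_def[abs_def] by (intro integrable_divide last_passage_integrable)

text \<open>Convergence in mean survives restriction to any event, and the limit is constant. The
  upper bound takes the whole space for \<open>B\<close>, the lower bound an event about row
  0.\<close>

lemma limit_shape_expectation:
  assumes "limit_shape M X Psi" and int: "\<And>z. integrable M (X z)"
    and "0 < x" "0 < y" and B: "B \<in> sets M"
  shows "(\<lambda>n. expectation (\<lambda>\<omega>. indicator B \<omega> * scaled_passage X x y n \<omega>)) \<longlonglongrightarrow> prob B * Psi x y"
proof -
  let ?Y = "scaled_passage X x y" and ?c = "Psi x y"
  have Y_int: "integrable M (?Y n)" for n
    by (rule scaled_passage_integrable[OF int])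
  have "(\<lambda>n. \<integral>\<^sup>+\<omega>. ennreal \<bar>?Y n \<omega> - ?c\<bar> \<partial>M) \<longlonglongrightarrow> 0"
    using assms unfolding limit_shape_def by blast
  moreover have "(\<integral>\<^sup>+\<omega>. ennreal \<bar>?Y n \<omega> - ?c\<bar> \<partial>M) = ennreal (expectation (\<lambda>\<omega>. \<bar>?Y n \<omega> - ?c\<bar>))" for n
    using Y_int by (intro nn_integral_eq_integral) auto
  ultimately have L1: "(\<lambda>n. expectation (\<lambda>\<omega>. \<bar>?Y n \<omega> - ?c\<bar>)) \<longlonglongrightarrow> 0"
    using tendsto_ennreal_iff[where x = 0 and f = "\<lambda>n. expectation (\<lambda>\<omega>. \<bar>?Y n \<omega> - ?c\<bar>)" and F = sequentially]
    by simp
  have "(\<lambda>n. expectation (\<lambda>\<omega>. indicator B \<omega> * ?Y n \<omega>) - prob B * ?c) \<longlonglongrightarrow> 0"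
  proof (rule tendsto_0_le[OF L1, where K = 1], rule always_eventually, rule allI)
    fix n
    have int_BY: "integrable M (\<lambda>\<omega>. indicator B \<omega> * ?Y n \<omega>)"
      using integrable_mult_indicator[OF B Y_int] by simp
    have "expectation (\<lambda>\<omega>. indicator B \<omega> * ?Y n \<omega>) - prob B * ?c =
        expectation (\<lambda>\<omega>. indicator B \<omega> * ?Y n \<omega> - indicator B \<omega> * ?c)"
      using int_BY B by (subst Bochner_Integration.integral_diff) (auto simp: emeasure_eq_measure)
    also have "\<bar>\<dots>\<bar> \<le> expectation (\<lambda>\<omega>. \<bar>?Y n \<omega> - ?c\<bar>)"
    proof (rule order_trans[OF integral_abs_bound], rule integral_mono)
      show "integrable M (\<lambda>\<omega>. \<bar>indicator B \<omega> * ?Y n \<omega> - indicator B \<omega> * ?c\<bar>)"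
        using int_BY B by (auto simp: emeasure_eq_measure)
    qed (use Y_int in \<open>auto simp: indicator_def\<close>)
    finally show "norm (expectation (\<lambda>\<omega>. indicator B \<omega> * ?Y n \<omega>) - prob B * ?c) \<le>
        norm (expectation (\<lambda>\<omega>. \<bar>?Y n \<omega> - ?c\<bar>)) * 1"
      by simp
  qed
  then show ?thesis by (rule LIM_zero_cancel)
qed

lemma limit_shape_ge:
  assumes iid: "iid_environment M F" and lim: "limit_shape M X Psi"
    and int: "\<And>z. integrable M (X z)" and "0 < \<alpha>"
    and B_pos: "0 < prob {\<omega> \<in> space M. s \<le> dist_mean (F 0 \<omega>)}"
  shows "s - \<alpha> * expectation (\<lambda>\<omega>. \<bar>X (0, 0) \<omega>\<bar>) \<le> Psi 1 \<alpha>"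
proof -
  note [measurable] = weight_measurable dist_mean_env_measurable dist_mean_measurable
  define C where "C = expectation (\<lambda>\<omega>. \<bar>X (0, 0) \<omega>\<bar>)"
  \<comment> \<open>The event \<open>B\<close> viewed as a set of distributions, the form in which
    the averaging lemmas test a row; \<open>EB\<close> translates between the two.\<close>
  define E where "E = {G \<in> space (prob_algebra borel). s \<le> dist_mean G}"
  define B where "B = {\<omega> \<in> space M. s \<le> dist_mean (F 0 \<omega>)}"
  let ?p = "prob B"
  have B [measurable]: "B \<in> sets M" unfolding B_def by measurable
  have E: "E \<in> sets (prob_algebra borel)" unfolding E_def by measurable
  have EB: "indicator E (F 0 \<omega>) = indicator B \<omega>" if "\<omega> \<in> space M" for \<omega>
    using that measurable_space[OF env_measurable that, of 0] by (simp add: E_def B_def indicator_def)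
  have C_nonneg: "0 \<le> C" unfolding C_def by simp
  have int_B: "integrable M (\<lambda>\<omega>. indicator B \<omega> * X z \<omega>)" for z
    using integrable_mult_indicator[OF B int] by simp
  have row: "s * ?p \<le> expectation (\<lambda>\<omega>. indicator B \<omega> * X (i, 0) \<omega>)" for i
  proof -
    have "s * ?p = expectation (\<lambda>\<omega>. indicator B \<omega> * s)" by simp
    also have "\<dots> \<le> expectation (\<lambda>\<omega>. indicator E (F 0 \<omega>) * dist_mean (F 0 \<omega>))"
    proof (rule integral_mono)
      show "integrable M (\<lambda>\<omega>. indicator B \<omega> * s)" by (simp add: emeasure_eq_measure)
      show "integrable M (\<lambda>\<omega>. indicator E (F 0 \<omega>) * dist_mean (F 0 \<omega>))"
        using expectation_weight(1)[OF int E, of 0 "(i, 0)"] by simp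
      show "indicator B \<omega> * s \<le> indicator E (F 0 \<omega>) * dist_mean (F 0 \<omega>)" if "\<omega> \<in> space M" for \<omega>
        unfolding EB[OF that] by (simp add: B_def indicator_def)
    qed
    also have "\<dots> = expectation (\<lambda>\<omega>. indicator E (F 0 \<omega>) * X (i, 0) \<omega>)"
      using expectation_weight(2)[OF int E, of 0 "(i, 0)"] by simp
    also have "\<dots> = expectation (\<lambda>\<omega>. indicator B \<omega> * X (i, 0) \<omega>)"
      by (intro Bochner_Integration.integral_cong) (simp_all add: EB)
    finally show ?thesis .
  qed
  have law: "(\<integral>\<^sup>+\<omega>. ennreal \<bar>X z \<omega>\<bar> \<partial>M) = ennreal C" for z
  proof -
    have "(\<integral>\<^sup>+\<omega>. ennreal \<bar>X z \<omega>\<bar> \<partial>M) = (\<integral>\<^sup>+\<omega>. ennreal \<bar>X (0, 0) \<omega>\<bar> \<partial>M)"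
      using nn_integral_weight_law[OF iid, of "\<lambda>x. ennreal \<bar>x\<bar>"] by simp
    also have "\<dots> = ennreal C"
      unfolding C_def using int by (intro nn_integral_eq_integral) auto
    finally show ?thesis .
  qed
  have column_nn: "ennreal (expectation (\<lambda>\<omega>. indicator B \<omega> * \<bar>X z \<omega>\<bar>)) =
      (\<integral>\<^sup>+\<omega>. indicator E (F 0 \<omega>) * ennreal \<bar>X z \<omega>\<bar> \<partial>M)" for z
  proof -
    have "integrable M (\<lambda>\<omega>. indicator B \<omega> * \<bar>X z \<omega>\<bar>)"
      using integrable_mult_indicator[OF B integrable_abs[OF int]] by simp
    then have "ennreal (expectation (\<lambda>\<omega>. indicator B \<omega> * \<bar>X z \<omega>\<bar>)) =
        (\<integral>\<^sup>+\<omega>. ennreal (indicator B \<omega> * \<bar>X z \<omega>\<bar>) \<partial>M)"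
      by (intro nn_integral_eq_integral[symmetric]) auto
    also have "\<dots> = (\<integral>\<^sup>+\<omega>. indicator E (F 0 \<omega>) * ennreal \<bar>X z \<omega>\<bar> \<partial>M)"
      by (intro nn_integral_cong) (simp add: EB ennreal_mult ennreal_indicator)
    finally show ?thesis .
  qed
  \<comment> \<open>This crude bound serves the corner \<open>(k, 0)\<close>, which lies in row 0
    and is therefore not covered by independence from \<open>B\<close>. A single site disappears
    after division by \<open>n\<close>.\<close>
  have column0: "expectation (\<lambda>\<omega>. indicator B \<omega> * \<bar>X z \<omega>\<bar>) \<le> C" for z
  proof -
    have "(\<integral>\<^sup>+\<omega>. indicator E (F 0 \<omega>) * ennreal \<bar>X z \<omega>\<bar> \<partial>M) \<le> (\<integral>\<^sup>+\<omega>. ennreal \<bar>X z \<omega>\<bar> \<partial>M)"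
      by (intro nn_integral_mono) (auto simp: indicator_def)
    then show ?thesis
      using column_nn[of z] law[of z] C_nonneg by (metis ennreal_le_iff)
  qed
  have column: "expectation (\<lambda>\<omega>. indicator B \<omega> * \<bar>X z \<omega>\<bar>) = ?p * C" if "snd z \<noteq> 0" for z
  proof -
    have "(\<integral>\<^sup>+\<omega>. indicator E (F 0 \<omega>) * ennreal \<bar>X z \<omega>\<bar> \<partial>M) =
        (\<integral>\<^sup>+\<omega>. indicator E (F 0 \<omega>) \<partial>M) * ennreal C"
      using nn_integral_weight_independent_row[OF iid _ E, of "\<lambda>x. ennreal \<bar>x\<bar>" 0 z] that
      by (simp add: law)
    also have "(\<integral>\<^sup>+\<omega>. indicator E (F 0 \<omega>) \<partial>M) = (\<integral>\<^sup>+\<omega>. indicator B \<omega> \<partial>M)"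
      by (intro nn_integral_cong) (simp add: EB)
    also have "\<dots> * ennreal C = ennreal (?p * C)"
      using C_nonneg by (simp add: emeasure_eq_measure ennreal_mult)
    finally have "ennreal (expectation (\<lambda>\<omega>. indicator B \<omega> * \<bar>X z \<omega>\<bar>)) = ennreal (?p * C)"
      using column_nn by simp
    then show ?thesis using C_nonneg by (subst (asm) ennreal_inj) auto
  qed
  \<comment> \<open>The last \<open>C\<close> pays for the corner site. All other column sites cost
    \<open>?p * C\<close>, so that \<open>?p\<close> cancels in the limit and the loss does not
    depend on how small it is.\<close>
  have T_ge: "k * (s * ?p) - l * (?p * C) - C \<le>
      expectation (\<lambda>\<omega>. indicator B \<omega> * last_passage (\<lambda>z. X z \<omega>) k l)" for k l
  proof -
    have neg: "- expectation (\<lambda>\<omega>. indicator B \<omega> * \<bar>X z \<omega>\<bar>) \<le> expectation (\<lambda>\<omega>. indicator B \<omega> * X z \<omega>)" for z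
      using integral_abs_bound[of M "\<lambda>\<omega>. indicator B \<omega> * X z \<omega>"] by (simp add: abs_mult)
    have "- (l * (?p * C)) - C = (\<Sum>j<l. - (?p * C)) - C" by simp
    also have "\<dots> \<le> (\<Sum>j<l. expectation (\<lambda>\<omega>. indicator B \<omega> * X (k, j) \<omega>))"
    proof (cases l)
      case (Suc l')
      have "- C \<le> expectation (\<lambda>\<omega>. indicator B \<omega> * X (k, 0) \<omega>)"
        using neg[of "(k, 0)"] column0[of "(k, 0)"] by linarith
      moreover have "- (?p * C) \<le> expectation (\<lambda>\<omega>. indicator B \<omega> * X (k, Suc j) \<omega>)" for j
        using neg[of "(k, Suc j)"] column[of "(k, Suc j)"] by simp
      then have "(\<Sum>j<l'. - (?p * C)) \<le> (\<Sum>j<l'. expectation (\<lambda>\<omega>. indicator B \<omega> * X (k, Suc j) \<omega>))"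
        by (intro sum_mono)
      moreover have "0 \<le> ?p * C" using C_nonneg by simp
      ultimately show ?thesis
        unfolding Suc sum.lessThan_Suc_shift by linarith
    qed (use C_nonneg in simp)
    finally have col: "- (l * (?p * C)) - C \<le> (\<Sum>j<l. expectation (\<lambda>\<omega>. indicator B \<omega> * X (k, j) \<omega>))" .
    have "(\<Sum>i<k. s * ?p) \<le> (\<Sum>i<k. expectation (\<lambda>\<omega>. indicator B \<omega> * X (i, 0) \<omega>))"
      by (intro sum_mono row)
    with col have "k * (s * ?p) - l * (?p * C) - C \<le>
        (\<Sum>i<k. expectation (\<lambda>\<omega>. indicator B \<omega> * X (i, 0) \<omega>)) +
        (\<Sum>j<l. expectation (\<lambda>\<omega>. indicator B \<omega> * X (k, j) \<omega>))"
      by simp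
    also have "\<dots> = expectation (\<lambda>\<omega>. (\<Sum>i<k. indicator B \<omega> * X (i, 0) \<omega>) + (\<Sum>j<l. indicator B \<omega> * X (k, j) \<omega>))"
      by (simp only: Bochner_Integration.integral_add Bochner_Integration.integral_sum
          Bochner_Integration.integrable_sum int_B)
    also have "\<dots> \<le> expectation (\<lambda>\<omega>. indicator B \<omega> * last_passage (\<lambda>z. X z \<omega>) k l)"
    proof (rule integral_mono)
      show "integrable M (\<lambda>\<omega>. indicator B \<omega> * last_passage (\<lambda>z. X z \<omega>) k l)"
        using integrable_mult_indicator[OF B last_passage_integrable[OF int]] by simp
      show "(\<Sum>i<k. indicator B \<omega> * X (i, 0) \<omega>) + (\<Sum>j<l. indicator B \<omega> * X (k, j) \<omega>) \<le>
          indicator B \<omega> * last_passage (\<lambda>z. X z \<omega>) k l" for \<omega>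
        using last_passage_ge_corner[of "\<lambda>z. X z \<omega>" k l] by (simp add: indicator_def)
    qed (intro Bochner_Integration.integrable_add Bochner_Integration.integrable_sum int_B)
    finally show ?thesis .
  qed
  have "(\<lambda>n. expectation (\<lambda>\<omega>. indicator B \<omega> * scaled_passage X 1 \<alpha> n \<omega>)) \<longlonglongrightarrow> ?p * Psi 1 \<alpha>"
    using limit_shape_expectation[OF lim int _ \<open>0 < \<alpha>\<close> B] by simp
  moreover have "(\<lambda>n. s * ?p - \<alpha> * (?p * C) - C / real n) \<longlonglongrightarrow> s * ?p - \<alpha> * (?p * C) - 0"
    by (intro tendsto_intros lim_const_over_n)
  moreover have "\<forall>\<^sub>F n in sequentially. s * ?p - \<alpha> * (?p * C) - C / real n \<le>
      expectation (\<lambda>\<omega>. indicator B \<omega> * scaled_passage X 1 \<alpha> n \<omega>)"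
    using eventually_gt_at_top[of 0]
  proof eventually_elim
    case (elim n)
    let ?l = "nat \<lfloor>real n * \<alpha>\<rfloor>"
    have "?l \<le> n * \<alpha>" using \<open>0 < \<alpha>\<close> by simp
    then have "?l * (?p * C) \<le> n * \<alpha> * (?p * C)"
      using C_nonneg by (intro mult_right_mono) auto
    then have "n * (s * ?p - \<alpha> * (?p * C) - C / n) \<le> n * (s * ?p) - ?l * (?p * C) - C"
      using elim by (simp add: algebra_simps)
    also have "\<dots> \<le> expectation (\<lambda>\<omega>. indicator B \<omega> * last_passage (\<lambda>z. X z \<omega>) n ?l)"
      by (rule T_ge)
    also have "\<dots> = n * expectation (\<lambda>\<omega>. indicator B \<omega> * scaled_passage X 1 \<alpha> n \<omega>)"
      using elim by (simp add: scaled_passage_def)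
    finally show ?case using elim by simp
  qed
  ultimately have "s * ?p - \<alpha> * (?p * C) \<le> ?p * Psi 1 \<alpha>"
    using tendsto_le[OF sequentially_bot] by fastforce
  then have "?p * (s - \<alpha> * C) \<le> ?p * Psi 1 \<alpha>" by (simp add: algebra_simps)
  then show ?thesis using B_pos by (simp add: B_def C_def)
qed

end

section \<open>Behaviour of the limit shape near the axis\<close>

theorem theorem4p2p1:
  fixes M :: "'a measure"
    and F :: "nat \<Rightarrow> 'a \<Rightarrow> real measure"
    and X :: "nat \<times> nat \<Rightarrow> 'a \<Rightarrow> real"
    and Psi :: "real \<Rightarrow> real \<Rightarrow> real"
    and t0 K0 :: real
    and mu_star :: ereal
  assumes "random_environment M F X"
    and "iid_environment M F"
    and "limit_shape M X Psi"
    and "\<And>z. integrable M (X z)"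
    and "(\<integral>\<^sup>+x\<in>{0..}. ennreal (sqrt (1 - (\<integral>\<omega>. cdf (F 0 \<omega>) x \<partial>M))) \<partial>lborel) < \<infinity>"
    and "(\<integral>\<^sup>+x\<in>{0..}. esssup M (\<lambda>\<omega>. ennreal (1 - cdf (F 0 \<omega>) x)) \<partial>lborel) < \<infinity>"
    and "t0 > 0"
    and "esssup M (\<lambda>\<omega>. \<integral>\<^sup>+x. ennreal (exp (t0 * \<bar>x - dist_mean (F 0 \<omega>)\<bar>)) \<partial>F 0 \<omega>) < ennreal K0"
  defines "mu_star \<equiv> esssup M (\<lambda>\<omega>. ereal (dist_mean (F 0 \<omega>)))"
  shows "\<bar>mu_star\<bar> \<noteq> \<infinity> \<and>
         (\<lambda>\<alpha>. Psi 1 \<alpha> - real_of_ereal mu_star)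
           \<in> O[at_right 0](\<lambda>\<alpha>. sqrt (\<alpha> * ln (1 / \<alpha>)))"
proof -
  interpret random_environment M F X by fact
  note iid = assms(2) and lim = assms(3) and int = assms(4) and t0 = assms(7)
  note [measurable] = dist_mean_env_measurable dist_mean_measurable

  \<comment> \<open>Lower bound below the essential supremum, and its finiteness\<close>
  define C where "C = expectation (\<lambda>\<omega>. \<bar>X (0, 0) \<omega>\<bar>)"
  have C_nonneg: "0 \<le> C" unfolding C_def by simp
  have lower: "s - \<alpha> * C \<le> Psi 1 \<alpha>"
    if "ereal s < mu_star" "0 < \<alpha>" for s \<alpha>
  proof -
    have "0 < emeasure M {\<omega> \<in> space M. ereal (dist_mean (F 0 \<omega>)) > ereal s}"
      using that(1) unfolding mu_star_def by (intro esssup_pos_measure) auto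
    also have "\<dots> \<le> emeasure M {\<omega> \<in> space M. s \<le> dist_mean (F 0 \<omega>)}"
      by (intro emeasure_mono) auto
    finally have "0 < prob {\<omega> \<in> space M. s \<le> dist_mean (F 0 \<omega>)}"
      by (simp add: emeasure_eq_measure)
    from limit_shape_ge[OF iid lim int that(2) this] show ?thesis by (simp add: C_def)
  qed
  have mu_AE: "AE \<omega> in M. ereal (dist_mean (F 0 \<omega>)) \<le> mu_star"
    unfolding mu_star_def by (rule esssup_AE)
  have "mu_star \<noteq> -\<infinity>"
  proof
    assume "mu_star = -\<infinity>"
    with mu_AE have "AE \<omega> in M. False" by simp
    then show False by simp
  qed
  \<comment> \<open>At \<alpha> = 1 the lower bound caps every real \<open>s\<close> below
    \<open>mu_star\<close> by the same finite number.\<close>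
  moreover have "mu_star \<le> ereal (Psi 1 1 + C)"
  proof (rule dense_le)
    fix y assume "y < mu_star"
    then show "y \<le> ereal (Psi 1 1 + C)"
    proof (cases y)
      case (real s)
      with lower[of s 1] \<open>y < mu_star\<close> show ?thesis by simp
    qed auto
  qed
  ultimately obtain m where m: "mu_star = ereal m"
    by (cases mu_star) auto

  \<comment> \<open>Almost sure bounds for all rows simultaneously\<close>
  have mean: "AE \<omega> in M. \<forall>j. dist_mean (F j \<omega>) \<le> m"
    unfolding AE_all_countable
  proof
    fix j
    have "{G \<in> space (prob_algebra borel). dist_mean G \<le> m} \<in> sets (prob_algebra borel)"
      by measurable
    moreover have "AE \<omega> in M. dist_mean (F 0 \<omega>) \<le> m"
      using mu_AE unfolding m by simp
    ultimately show "AE \<omega> in M. dist_mean (F j \<omega>) \<le> m"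
      by (rule AE_env_eq[OF iid])
  qed
  \<comment> \<open>A nonpositive \<open>K0\<close> would make \<open>ennreal K0\<close> zero, and
    nothing lies strictly below zero there.\<close>
  have K0: "0 < K0"
  proof (rule ccontr)
    assume "\<not> 0 < K0"
    then have "ennreal K0 = 0" by (simp add: ennreal_neg)
    with assms(8) show False by simp
  qed
  have mom: "AE \<omega> in M. \<forall>j. (\<integral>\<^sup>+x. ennreal (exp (t0 * \<bar>x - dist_mean (F j \<omega>)\<bar>)) \<partial>F j \<omega>) \<le> ennreal K0"
    unfolding AE_all_countable
  proof
    fix j
    have "(\<lambda>G. \<integral>\<^sup>+x. ennreal (exp (t0 * \<bar>x - dist_mean G\<bar>)) \<partial>G) \<in> borel_measurable (prob_algebra borel)"
      by (rule nn_integral_measurable_prob_algebra) measurable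
    then have "{G \<in> space (prob_algebra borel).
        (\<integral>\<^sup>+x. ennreal (exp (t0 * \<bar>x - dist_mean G\<bar>)) \<partial>G) \<le> ennreal K0} \<in> sets (prob_algebra borel)"
      by measurable
    moreover have "AE \<omega> in M. (\<integral>\<^sup>+x. ennreal (exp (t0 * \<bar>x - dist_mean (F 0 \<omega>)\<bar>)) \<partial>F 0 \<omega>) \<le> ennreal K0"
      using esssup_AE by eventually_elim (use assms(8) in \<open>auto intro: order_trans less_imp_le\<close>)
    ultimately show "AE \<omega> in M. (\<integral>\<^sup>+x. ennreal (exp (t0 * \<bar>x - dist_mean (F j \<omega>)\<bar>)) \<partial>F j \<omega>) \<le> ennreal K0"
      by (rule AE_env_eq[OF iid])
  qed

  \<comment> \<open>Upper bound with \<theta> equal to the target error \<open>r\<close>\<close>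
  define c where "c = 4 * K0 / t0\<^sup>2"
  have c: "0 \<le> c" using K0 by (simp add: c_def)
  \<comment> \<open>In the constant, \<bar>m\<bar> pays for the means of the additional
    \<open>?l\<close> sites, \<open>2 * c\<close> for the moments of at most \<open>2 * n\<close>
    sites, and 3 for the path count with walk probabilities \<open>1 - \<alpha>\<close> and
    \<alpha>: 2 from the horizontal steps, 1 from the vertical ones.\<close>
  have upper: "Psi 1 \<alpha> \<le> m + (\<bar>m\<bar> + 3 + 2 * c) * r"
    if \<alpha>: "0 < \<alpha>" "\<alpha> < 1 / 2" "1 \<le> ln (1 / \<alpha>)" and r: "r = sqrt (\<alpha> * ln (1 / \<alpha>))" "r \<le> t0 / 2" for \<alpha> r
  proof -
    define L where "L = ln (1 / \<alpha>)"
    have L: "1 \<le> L" "L = - ln \<alpha>" using \<alpha> by (auto simp: L_def ln_div)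
    have "0 < \<alpha> * L" using \<alpha>(1) L(1) by (intro mult_pos_pos) linarith+
    then have r2: "r\<^sup>2 = \<alpha> * L" and r_pos: "0 < r"
      unfolding r(1) L_def[symmetric] by simp_all
    have "\<alpha> \<le> \<alpha> * L" using mult_left_mono[OF L(1)] \<alpha> by simp
    then have \<alpha>_r2: "\<alpha> \<le> r\<^sup>2" using r2 by simp
    have \<alpha>_r: "\<alpha> \<le> r"
    proof (rule power2_le_imp_le)
      have "\<alpha>\<^sup>2 \<le> \<alpha>" using \<alpha> by (simp add: power2_eq_square mult_le_cancel_left1)
      then show "\<alpha>\<^sup>2 \<le> r\<^sup>2" using \<alpha>_r2 by linarith
    qed (use r_pos in simp)
    \<comment> \<open>The condition \<alpha> < 1 / 2 makes the horizontal steps cost at most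
      \<open>2 * \<alpha>\<close> each, and \<alpha> is at most \<open>r\<^sup>2\<close> because the
      logarithm is at least one.\<close>
    have "- \<alpha> - 2 * \<alpha>\<^sup>2 \<le> ln (1 - \<alpha>)" using \<alpha> ln_one_minus_pos_lower_bound[of \<alpha>] by simp
    moreover have "\<alpha> * \<alpha> \<le> \<alpha> * (1 / 2)" using \<alpha> by (intro mult_left_mono) auto
    then have "2 * \<alpha>\<^sup>2 \<le> \<alpha>" by (simp add: power2_eq_square)
    ultimately have ln_x: "- ln (1 - \<alpha>) \<le> 2 * \<alpha>" by linarith
    have mom': "AE \<omega> in M. \<forall>j. (\<integral>\<^sup>+x. ennreal (exp (r * (x - dist_mean (F j \<omega>)))) \<partial>F j \<omega>) \<le> ennreal (exp (c * r\<^sup>2))"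
      using mom AE_space
    proof eventually_elim
      case (elim \<omega>)
      show ?case
        unfolding c_def
        using elim r_pos r(2) t0 K0
        by (intro allI nn_integral_exp_centered_le env_prob_space) auto
    qed
    have bound: "expectation (\<lambda>\<omega>. indicator (space M) \<omega> * scaled_passage X 1 \<alpha> n \<omega>) \<le>
        m + (\<bar>m\<bar> + 3 + 2 * c) * r" if n: "0 < n" for n
    proof -
      let ?l = "nat \<lfloor>real n * \<alpha>\<rfloor>"
      have l: "?l \<le> n * \<alpha>" using \<alpha> by simp
      have lm: "?l * m \<le> n * \<alpha> * \<bar>m\<bar>"
        using l by (smt (verit) mult_left_mono mult_right_mono of_nat_0_le_iff)
      have lL: "?l * L \<le> n * (\<alpha> * L)"
        using mult_right_mono[OF l, of L] L by simp
      have "c * r\<^sup>2 * (n + ?l) \<le> c * r\<^sup>2 * (2 * n)"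
      proof (intro mult_left_mono)
        have "real n * \<alpha> \<le> real n * 1" using \<alpha> by (intro mult_left_mono) auto
        then show "real (n + ?l) \<le> real (2 * n)" using l by simp
      qed (use c in simp)
      moreover have "- (n * ln (1 - \<alpha>)) \<le> n * (2 * \<alpha>)"
        using mult_left_mono[OF ln_x, of "real n"] by simp
      moreover have "n * (2 * \<alpha>) \<le> n * (2 * r\<^sup>2)"
        using \<alpha>_r2 by (intro mult_left_mono) auto
      moreover have "- (?l * ln \<alpha>) \<le> n * r\<^sup>2"
        using lL unfolding r2 L(2) by simp
      ultimately have "c * r\<^sup>2 * (n + ?l) - n * ln (1 - \<alpha>) - ?l * ln \<alpha> \<le>
          c * r\<^sup>2 * (2 * n) + n * (2 * r\<^sup>2) + n * r\<^sup>2"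
        by linarith
      also have "\<dots> = n * ((3 + 2 * c) * r\<^sup>2)" by (simp add: algebra_simps)
      finally have "(c * r\<^sup>2 * (n + ?l) - n * ln (1 - \<alpha>) - ?l * ln \<alpha>) / r \<le> n * ((3 + 2 * c) * r\<^sup>2) / r"
        using r_pos by (intro divide_right_mono) auto
      also have "\<dots> = n * ((3 + 2 * c) * r)"
        using r_pos by (simp add: power2_eq_square)
      finally have err: "(c * r\<^sup>2 * (n + ?l) - n * ln (1 - \<alpha>) - ?l * ln \<alpha>) / r \<le> n * ((3 + 2 * c) * r)" .
      have "n * (\<alpha> * \<bar>m\<bar>) \<le> n * (r * \<bar>m\<bar>)"
        using \<alpha>_r by (intro mult_left_mono mult_right_mono) auto
      then have means: "(n + ?l) * m \<le> n * m + n * (r * \<bar>m\<bar>)"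
        using lm by (simp add: algebra_simps)
      have "expectation (\<lambda>\<omega>. last_passage (\<lambda>z. X z \<omega>) n ?l) \<le>
          (n + ?l) * m + (c * r\<^sup>2 * (n + ?l) - n * ln (1 - \<alpha>) - ?l * ln \<alpha>) / r"
        using expectation_last_passage_le[OF int mom' mean r_pos, of "1 - \<alpha>" \<alpha> n ?l] \<alpha> by simp
      also have "\<dots> \<le> n * (m + (\<bar>m\<bar> + 3 + 2 * c) * r)"
        using err means by (simp add: algebra_simps)
      finally have "expectation (\<lambda>\<omega>. last_passage (\<lambda>z. X z \<omega>) n ?l) / n \<le> m + (\<bar>m\<bar> + 3 + 2 * c) * r"
        using n by (simp add: field_simps)
      moreover have "expectation (\<lambda>\<omega>. indicator (space M) \<omega> * scaled_passage X 1 \<alpha> n \<omega>) =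
          expectation (\<lambda>\<omega>. last_passage (\<lambda>z. X z \<omega>) n ?l / n)"
        by (intro Bochner_Integration.integral_cong) (simp_all add: scaled_passage_def)
      ultimately show ?thesis by simp
    qed
    have "(\<lambda>n. expectation (\<lambda>\<omega>. indicator (space M) \<omega> * scaled_passage X 1 \<alpha> n \<omega>)) \<longlonglongrightarrow> Psi 1 \<alpha>"
      using limit_shape_expectation[OF lim int _ \<alpha>(1) sets.top, of 1] by (simp add: prob_space)
    then show ?thesis
      by (rule LIMSEQ_le_const2) (use bound in \<open>auto intro: exI[of _ 1]\<close>)
  qed
  \<comment> \<open>The error in \<open>lower\<close> is the same for every \<open>s\<close>, so
    \<open>s\<close> can increase to \<open>m\<close> at fixed \<alpha>.\<close>
  have lower': "m - \<alpha> * C \<le> Psi 1 \<alpha>" if "0 < \<alpha>" for \<alpha>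
  proof (rule dense_le)
    fix y assume "y < m - \<alpha> * C"
    then show "y \<le> Psi 1 \<alpha>"
      using lower[of "y + \<alpha> * C" \<alpha>] m that by simp
  qed
  have "(\<lambda>\<alpha>. Psi 1 \<alpha> - m) \<in> O[at_right 0](\<lambda>\<alpha>. sqrt (\<alpha> * ln (1 / \<alpha>)))"
  \<comment> \<open>The constant of the upper bound plus \<open>C\<close> from the lower one, whose
    linear error in \<alpha> is absorbed because \<alpha> is at most \<open>r\<close>.\<close>
  proof (rule bigoI[where c = "\<bar>m\<bar> + 3 + 2 * c + C"])
    have "((\<lambda>\<alpha>::real. sqrt (\<alpha> * ln (1 / \<alpha>))) \<longlongrightarrow> 0) (at_right 0)"
      by real_asymp
    then have "\<forall>\<^sub>F \<alpha> in at_right 0. sqrt (\<alpha> * ln (1 / \<alpha>)) < t0 / 2"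
      using t0 by (intro order_tendstoD) auto
    moreover have "\<forall>\<^sub>F \<alpha> in at_right (0::real). 0 < \<alpha> \<and> \<alpha> < 1 / 2 \<and> 1 \<le> ln (1 / \<alpha>)"
      by (intro eventually_conj; real_asymp)
    ultimately show "\<forall>\<^sub>F \<alpha> in at_right 0. norm (Psi 1 \<alpha> - m) \<le>
        (\<bar>m\<bar> + 3 + 2 * c + C) * norm (sqrt (\<alpha> * ln (1 / \<alpha>)))"
    proof eventually_elim
      case (elim \<alpha>)
      define r where "r = sqrt (\<alpha> * ln (1 / \<alpha>))"
      have up: "Psi 1 \<alpha> \<le> m + (\<bar>m\<bar> + 3 + 2 * c) * r"
        using elim by (intro upper) (auto simp: r_def)
      have r0: "0 \<le> r" using elim by (simp add: r_def)
      have "\<alpha> \<le> r"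
        unfolding r_def
      proof (rule real_le_rsqrt)
        have "\<alpha> * \<alpha> \<le> \<alpha> * ln (1 / \<alpha>)" using elim by (intro mult_left_mono) auto
        then show "\<alpha>\<^sup>2 \<le> \<alpha> * ln (1 / \<alpha>)" by (simp add: power2_eq_square)
      qed
      then have "\<alpha> * C \<le> r * C" using C_nonneg by (intro mult_right_mono)
      moreover have "m - \<alpha> * C \<le> Psi 1 \<alpha>" using elim by (intro lower') auto
      moreover have "0 \<le> (\<bar>m\<bar> + 3 + 2 * c) * r" "0 \<le> r * C"
        using r0 c C_nonneg by simp_all
      ultimately have "\<bar>Psi 1 \<alpha> - m\<bar> \<le> (\<bar>m\<bar> + 3 + 2 * c) * r + r * C"
        using up by linarith
      also have "\<dots> = (\<bar>m\<bar> + 3 + 2 * c + C) * r" by (simp add: algebra_simps)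
      finally have "\<bar>Psi 1 \<alpha> - m\<bar> \<le> (\<bar>m\<bar> + 3 + 2 * c + C) * r" .
      then show ?case using r0 by (simp add: r_def)
    qed
  qed
  then show ?thesis using m by simp
qed

end
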